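(* Let $\mathcal C$ be a complete and cocomplete category and let $\rho_1,\rho_2$ be height-difference functions on a poset $P$. If $(P,\rho_1)$ has the connected intersections property (CIP), then $d_{\rho_2}$ satisfies a $(c(\rho_1)+3\delta(\rho_1,\rho_2))$-relaxed triangle inequality, i.e. for all $M,X,N\in\mathrm{Fun}(P,\mathcal C)$, $$d_{\rho_2}(M,N)\le d_{\rho_2}(M,X)+d_{\rho_2}(X,N)+c(\rho_1)+3\,\delta(\rho_1,\rho_2).$$
   Context: A poset $P$ is regarded as a category (a unique morphism $a\to b$ iff $a\le b$), and $\mathrm{Fun}(P,\mathcal C)$ is the category of functors $P\to\mathcal C$ and natural transformations. All infima of empty sets are $\infty$. A height-difference function on $P$ is a function $\rho:\{(a,b)\in P\times P: a\le b\}\to[0,\infty]$ with $\rho(a,a)=0$ for all $a$ and $\rho(a,c)\ge\rho(a,b)+\rho(b,c)$ whenever $a\le b\le c$. For $a\in P$ and real $r\ge 0$ put $a^{\downarrow_r}=\{x\in P: x\le a,\ \rho(x,a)\ge r\}$ and $a^{\uparrow_r}=\{x\in P: x\ge a,\ \rho(a,x)\ge r\}$ (full subposets). Endofunctors $\mathsf L_r=\mathsf L_r^\rho$ and $\mathsf R_r=\mathsf R_r^\rho$ of $\mathrm{Fun}(P,\mathcal C)$: $(\mathsf L_rM)(a)=\operatorname{colim} M|_{a^{\downarrow_r}}$ and $(\mathsf R_rM)(a)=\lim M|_{a^{\uparrow_r}}$, with structure morphisms for $a\le b$ (using $a^{\downarrow_r}\subseteq b^{\downarrow_r}$, $b^{\uparrow_r}\subseteq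 a^{\uparrow_r}$) and the action on morphisms induced by the universal properties. Write $\alpha_{a,M}(x):M(x)\to(\mathsf L_rM)(a)$ ($x\in a^{\downarrow_r}$) and $\beta_{a,M}(y):(\mathsf R_rM)(a)\to M(y)$ ($y\in a^{\uparrow_r}$) for the canonical maps. The functor $\mathsf L_r$ is left adjoint to $\mathsf R_r$; for $p:M\to\mathsf R_rN$, its adjoint $p^\sharp:\mathsf L_rM\to N$ is the unique morphism with $p^\sharp(a)\circ\alpha_{a,M}(x)=\beta_{x,N}(a)\circ p(x)$ for all $a\in P$, $x\in a^{\downarrow_r}$. Let $\eta^{\mathsf L}_{r,M}:\mathsf L_rM\to M$ and $\eta^{\mathsf R}_{r,M}:M\to\mathsf R_rM$ be induced by the structure maps $M(x\le a)$, $x\in a^{\downarrow_r}$, respectively $M(a\le y)$, $y\in a^{\uparrow_r}$, and set $e_{r,M}=\eta^{\mathsf R}_{r,M}\circ\eta^{\mathsf L}_{r,M}:\mathsf L_rM\to\mathsf R_rM$. $M,N\in\mathrm{Fun}(P,\mathcal C)$ are $r$-height-interleaved with respect to $\rho$ if there are $p:M\to\mathsf R_rN$ and $q:N\to\mathsf R_rM$ with $e_{r,M}=q\circ p^\sharp$ and $e_{r,N}=p\circ q^\sharp$. The height-interleaving distance is $d_\rho(M,N)=\inf\{r\ge0: M,N \text{ are } r\text{-height-interleaved w.r.t. }\rho\}\in[0,\infty]$. CIP: $(P,\rho)$ has the connected intersections property if for all $a,q\in P$ and $s,r\ge0$ the full subposet $I_{s,r}(a,q)=a^{\downarrow_s}\cap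 q^{\uparrow_r}$ is empty or connected (any two elements are joined by a finite zigzag of comparabilities inside it). For $u,v\in[0,\infty]$ set $|u-v|_\infty=|u-v|$ if $u,v<\infty$, $0$ if $u=v=\infty$, and $\infty$ otherwise. For $c\ge0$, condition (IV$_c$) for $(P,\rho)$: for any $a\le b$ in $P$ and any $t\in[0,\infty)$ with $t\le\rho(a,b)$ there exists $z\in P$ with $a\le z\le b$, $|\rho(a,z)-t|_\infty\le c/2$ and $|\rho(z,b)-(\rho(a,b)-t)|_\infty\le c/2$. Then $c(\rho)=\inf\{c\ge0:(P,\rho)\text{ satisfies (IV}_c)\}\in[0,\infty]$. The distortion is $\delta(\rho_1,\rho_2)=\inf\{r\ge0: |\rho_1(a,b)-\rho_2(a,b)|_\infty\le r\text{ for all }a\le b\}$. *)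

theory Defs
  imports "HOL-Library.Extended_Nonnegative_Real" "HOL-Library.FuncSet"
begin

section \<open>Categories, functors, natural transformations\<close>

record ('o, 'm) cat =
  Obj :: "'o set"
  Arr :: "'m set"
  Dom :: "'m \<Rightarrow> 'o"
  Cod :: "'m \<Rightarrow> 'o"
  Ide :: "'o \<Rightarrow> 'm"
  Comp :: "'m \<Rightarrow> 'm \<Rightarrow> 'm"

abbreviation cat_comp :: "'m \<Rightarrow> ('o, 'm) cat \<Rightarrow> 'm \<Rightarrow> 'm"
    ("(_ \<cdot>\<^bsub>_\<^esub> _)" [56, 0, 55] 55) where
  "g \<cdot>\<^bsub>C\<^esub> f \<equiv> Comp C g f"

definition hom :: "('o, 'm) cat \<Rightarrow> 'o \<Rightarrow> 'o \<Rightarrow> 'm set" where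
  "hom C a b = {f \<in> Arr C. Dom C f = a \<and> Cod C f = b}"

locale category =
  fixes C :: "('o, 'm) cat"
  assumes dom_obj: "f \<in> Arr C \<Longrightarrow> Dom C f \<in> Obj C"
    and cod_obj: "f \<in> Arr C \<Longrightarrow> Cod C f \<in> Obj C"
    and ide_hom: "a \<in> Obj C \<Longrightarrow> Ide C a \<in> hom C a a"
    and comp_hom: "\<lbrakk>f \<in> hom C a b; g \<in> hom C b c\<rbrakk> \<Longrightarrow> g \<cdot>\<^bsub>C\<^esub> f \<in> hom C a c"
    and comp_ide_left: "f \<in> hom C a b \<Longrightarrow> Ide C b \<cdot>\<^bsub>C\<^esub> f = f"
    and comp_ide_right: "f \<in> hom C a b \<Longrightarrow> f \<cdot>\<^bsub>C\<^esub> Ide C a = f"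
    and comp_assoc: "\<lbrakk>f \<in> hom C a b; g \<in> hom C b c; h \<in> hom C c d\<rbrakk>
      \<Longrightarrow> (h \<cdot>\<^bsub>C\<^esub> g) \<cdot>\<^bsub>C\<^esub> f = h \<cdot>\<^bsub>C\<^esub> (g \<cdot>\<^bsub>C\<^esub> f)"

record ('o, 'm, 'p, 'n) fctr =
  on_obj :: "'o \<Rightarrow> 'p"
  on_arr :: "'m \<Rightarrow> 'n"

definition is_functor :: "('o, 'm) cat \<Rightarrow> ('p, 'n) cat \<Rightarrow> ('o, 'm, 'p, 'n) fctr \<Rightarrow> bool" where
  "is_functor J C F \<longleftrightarrow>
     (\<forall>a \<in> Obj J. on_obj F a \<in> Obj C) \<and>
     (\<forall>f \<in> Arr J. on_arr F f \<in> hom C (on_obj F (Dom J f)) (on_obj F (Cod J f))) \<and>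
     (\<forall>a \<in> Obj J. on_arr F (Ide J a) = Ide C (on_obj F a)) \<and>
     (\<forall>f \<in> Arr J. \<forall>g \<in> Arr J. Cod J f = Dom J g \<longrightarrow>
        on_arr F (g \<cdot>\<^bsub>J\<^esub> f) = on_arr F g \<cdot>\<^bsub>C\<^esub> on_arr F f)"

text \<open>Natural transformations are extensional (undefined outside the objects of the source
  category), so that equality in HOL is equality of morphisms of the functor category.\<close>

definition nat_trans ::
  "('o, 'm) cat \<Rightarrow> ('p, 'n) cat \<Rightarrow> ('o, 'm, 'p, 'n) fctr \<Rightarrow> ('o, 'm, 'p, 'n) fctr
     \<Rightarrow> ('o \<Rightarrow> 'n) set" where
  "nat_trans J C F G = {\<phi>.
     \<phi> \<in> extensional (Obj J) \<and>
     (\<forall>a \<in> Obj J. \<phi> a \<in> hom C (on_obj F a) (on_obj G a)) \<and>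
     (\<forall>f \<in> Arr J. \<phi> (Cod J f) \<cdot>\<^bsub>C\<^esub> on_arr F f = on_arr G f \<cdot>\<^bsub>C\<^esub> \<phi> (Dom J f))}"

definition vcomp :: "('o, 'm) cat \<Rightarrow> ('p, 'n) cat \<Rightarrow> ('o \<Rightarrow> 'n) \<Rightarrow> ('o \<Rightarrow> 'n) \<Rightarrow> ('o \<Rightarrow> 'n)" where
  "vcomp J C \<psi> \<phi> = (\<lambda>a \<in> Obj J. \<psi> a \<cdot>\<^bsub>C\<^esub> \<phi> a)"


section \<open>Limits and colimits\<close>

definition is_cone ::
  "('o, 'm) cat \<Rightarrow> ('p, 'n) cat \<Rightarrow> ('o, 'm, 'p, 'n) fctr \<Rightarrow> 'p \<Rightarrow> ('o \<Rightarrow> 'n) \<Rightarrow> bool" where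
  "is_cone J C D c \<kappa> \<longleftrightarrow>
     c \<in> Obj C \<and>
     (\<forall>j \<in> Obj J. \<kappa> j \<in> hom C c (on_obj D j)) \<and>
     (\<forall>f \<in> Arr J. on_arr D f \<cdot>\<^bsub>C\<^esub> \<kappa> (Dom J f) = \<kappa> (Cod J f))"

definition is_limit ::
  "('o, 'm) cat \<Rightarrow> ('p, 'n) cat \<Rightarrow> ('o, 'm, 'p, 'n) fctr \<Rightarrow> 'p \<Rightarrow> ('o \<Rightarrow> 'n) \<Rightarrow> bool" where
  "is_limit J C D c \<kappa> \<longleftrightarrow>
     is_cone J C D c \<kappa> \<and>
     (\<forall>c' \<kappa>'. is_cone J C D c' \<kappa>' \<longrightarrow>
        (\<exists>!h. h \<in> hom C c' c \<and> (\<forall>j \<in> Obj J. \<kappa> j \<cdot>\<^bsub>C\<^esub> h = \<kappa>' j)))"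

definition is_cocone ::
  "('o, 'm) cat \<Rightarrow> ('p, 'n) cat \<Rightarrow> ('o, 'm, 'p, 'n) fctr \<Rightarrow> 'p \<Rightarrow> ('o \<Rightarrow> 'n) \<Rightarrow> bool" where
  "is_cocone J C D c \<kappa> \<longleftrightarrow>
     c \<in> Obj C \<and>
     (\<forall>j \<in> Obj J. \<kappa> j \<in> hom C (on_obj D j) c) \<and>
     (\<forall>f \<in> Arr J. \<kappa> (Cod J f) \<cdot>\<^bsub>C\<^esub> on_arr D f = \<kappa> (Dom J f))"

definition is_colimit ::
  "('o, 'm) cat \<Rightarrow> ('p, 'n) cat \<Rightarrow> ('o, 'm, 'p, 'n) fctr \<Rightarrow> 'p \<Rightarrow> ('o \<Rightarrow> 'n) \<Rightarrow> bool" where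
  "is_colimit J C D c \<kappa> \<longleftrightarrow>
     is_cocone J C D c \<kappa> \<and>
     (\<forall>c' \<kappa>'. is_cocone J C D c' \<kappa>' \<longrightarrow>
        (\<exists>!h. h \<in> hom C c c' \<and> (\<forall>j \<in> Obj J. h \<cdot>\<^bsub>C\<^esub> \<kappa> j = \<kappa>' j)))"

text \<open>
  (Co)completeness means having all small (co)limits.  Smallness is relative to a universe, given
  here by a type \<open>'u\<close>: small categories have objects in \<open>'u\<close> and arrows in \<open>'u \<times> 'u\<close>.  For
  infinite \<open>'u\<close> these are, up to isomorphism, all categories with at most \<open>|'u|\<close> arrows.
\<close>

definition complete_category :: "'u itself \<Rightarrow> ('o, 'm) cat \<Rightarrow> bool" where
  "complete_category _ C \<longleftrightarrow>
     (\<forall>(J :: ('u, 'u \<times> 'u) cat) D. category J \<longrightarrow> is_functor J C D \<longrightarrow>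
        (\<exists>c \<kappa>. is_limit J C D c \<kappa>))"

definition cocomplete_category :: "'u itself \<Rightarrow> ('o, 'm) cat \<Rightarrow> bool" where
  "cocomplete_category _ C \<longleftrightarrow>
     (\<forall>(J :: ('u, 'u \<times> 'u) cat) D. category J \<longrightarrow> is_functor J C D \<longrightarrow>
        (\<exists>c \<kappa>. is_colimit J C D c \<kappa>))"

text \<open>A fixed choice of limit and colimit, as a pair of the apex and the family of legs.\<close>

definition lim_of ::
  "('o, 'm) cat \<Rightarrow> ('p, 'n) cat \<Rightarrow> ('o, 'm, 'p, 'n) fctr \<Rightarrow> 'p \<times> ('o \<Rightarrow> 'n)" where
  "lim_of J C D = (SOME (c, \<kappa>). is_limit J C D c \<kappa>)"

definition colim_of ::
  "('o, 'm) cat \<Rightarrow> ('p, 'n) cat \<Rightarrow> ('o, 'm, 'p, 'n) fctr \<Rightarrow> 'p \<times> ('o \<Rightarrow> 'n)" where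
  "colim_of J C D = (SOME (c, \<kappa>). is_colimit J C D c \<kappa>)"


section \<open>Posets and height-difference functions\<close>

text \<open>A poset is a carrier \<open>P\<close> with a relation \<open>le\<close> such that \<open>partial_order_on P le\<close>; the pair
  \<open>(a, b) \<in> le\<close> is the unique morphism from \<open>a\<close> to \<open>b\<close>.  For \<open>S \<subseteq> P\<close>, \<open>poset_cat S le\<close> is the full
  subposet on \<open>S\<close>; a functor on \<open>poset_cat P le\<close> is restricted to \<open>S\<close> by regarding the same
  \<open>fctr\<close> record as a functor on \<open>poset_cat S le\<close>.\<close>

definition poset_cat :: "'u set \<Rightarrow> 'u rel \<Rightarrow> ('u, 'u \<times> 'u) cat" where
  "poset_cat S le = \<lparr>Obj = S, Arr = le \<inter> S \<times> S, Dom = fst, Cod = snd,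
     Ide = (\<lambda>a. (a, a)), Comp = (\<lambda>g f. (fst f, snd g))\<rparr>"

type_synonym ('u, 'o, 'm) diagram = "('u, 'u \<times> 'u, 'o, 'm) fctr"

definition height_difference :: "'u set \<Rightarrow> 'u rel \<Rightarrow> ('u \<Rightarrow> 'u \<Rightarrow> ennreal) \<Rightarrow> bool" where
  "height_difference P le \<rho> \<longleftrightarrow>
     (\<forall>a \<in> P. \<rho> a a = 0) \<and>
     (\<forall>a b c. (a, b) \<in> le \<longrightarrow> (b, c) \<in> le \<longrightarrow> \<rho> a b + \<rho> b c \<le> \<rho> a c)"

definition down :: "'u rel \<Rightarrow> ('u \<Rightarrow> 'u \<Rightarrow> ennreal) \<Rightarrow> real \<Rightarrow> 'u \<Rightarrow> 'u set" where
  "down le \<rho> r a = {x. (x, a) \<in> le \<and> ennreal r \<le> \<rho> x a}"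

definition up :: "'u rel \<Rightarrow> ('u \<Rightarrow> 'u \<Rightarrow> ennreal) \<Rightarrow> real \<Rightarrow> 'u \<Rightarrow> 'u set" where
  "up le \<rho> r a = {x. (a, x) \<in> le \<and> ennreal r \<le> \<rho> a x}"


section \<open>The functors \<open>L\<^sub>r\<close> and \<open>R\<^sub>r\<close>\<close>

definition L_obj ::
  "'u rel \<Rightarrow> ('o, 'm) cat \<Rightarrow> ('u \<Rightarrow> 'u \<Rightarrow> ennreal) \<Rightarrow> real \<Rightarrow> ('u, 'o, 'm) diagram \<Rightarrow> 'u \<Rightarrow> 'o" where
  "L_obj le C \<rho> r M a = fst (colim_of (poset_cat (down le \<rho> r a) le) C M)"

definition alpha ::
  "'u rel \<Rightarrow> ('o, 'm) cat \<Rightarrow> ('u \<Rightarrow> 'u \<Rightarrow> ennreal) \<Rightarrow> real \<Rightarrow> ('u, 'o, 'm) diagram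
     \<Rightarrow> 'u \<Rightarrow> 'u \<Rightarrow> 'm" where
  "alpha le C \<rho> r M a = snd (colim_of (poset_cat (down le \<rho> r a) le) C M)"

definition R_obj ::
  "'u rel \<Rightarrow> ('o, 'm) cat \<Rightarrow> ('u \<Rightarrow> 'u \<Rightarrow> ennreal) \<Rightarrow> real \<Rightarrow> ('u, 'o, 'm) diagram \<Rightarrow> 'u \<Rightarrow> 'o" where
  "R_obj le C \<rho> r M a = fst (lim_of (poset_cat (up le \<rho> r a) le) C M)"

definition beta ::
  "'u rel \<Rightarrow> ('o, 'm) cat \<Rightarrow> ('u \<Rightarrow> 'u \<Rightarrow> ennreal) \<Rightarrow> real \<Rightarrow> ('u, 'o, 'm) diagram
     \<Rightarrow> 'u \<Rightarrow> 'u \<Rightarrow> 'm" where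
  "beta le C \<rho> r M a = snd (lim_of (poset_cat (up le \<rho> r a) le) C M)"

definition L_fun ::
  "'u rel \<Rightarrow> ('o, 'm) cat \<Rightarrow> ('u \<Rightarrow> 'u \<Rightarrow> ennreal) \<Rightarrow> real \<Rightarrow> ('u, 'o, 'm) diagram
     \<Rightarrow> ('u, 'o, 'm) diagram" where
  "L_fun le C \<rho> r M = \<lparr>on_obj = L_obj le C \<rho> r M,
     on_arr = (\<lambda>(a, b). THE h. h \<in> hom C (L_obj le C \<rho> r M a) (L_obj le C \<rho> r M b) \<and>
       (\<forall>x \<in> down le \<rho> r a. h \<cdot>\<^bsub>C\<^esub> alpha le C \<rho> r M a x = alpha le C \<rho> r M b x))\<rparr>"

definition R_fun ::
  "'u rel \<Rightarrow> ('o, 'm) cat \<Rightarrow> ('u \<Rightarrow> 'u \<Rightarrow> ennreal) \<Rightarrow> real \<Rightarrow> ('u, 'o, 'm) diagram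
     \<Rightarrow> ('u, 'o, 'm) diagram" where
  "R_fun le C \<rho> r M = \<lparr>on_obj = R_obj le C \<rho> r M,
     on_arr = (\<lambda>(a, b). THE h. h \<in> hom C (R_obj le C \<rho> r M a) (R_obj le C \<rho> r M b) \<and>
       (\<forall>y \<in> up le \<rho> r b. beta le C \<rho> r M b y \<cdot>\<^bsub>C\<^esub> h = beta le C \<rho> r M a y))\<rparr>"

definition adjunct ::
  "'u set \<Rightarrow> 'u rel \<Rightarrow> ('o, 'm) cat \<Rightarrow> ('u \<Rightarrow> 'u \<Rightarrow> ennreal) \<Rightarrow> real
     \<Rightarrow> ('u, 'o, 'm) diagram \<Rightarrow> ('u, 'o, 'm) diagram \<Rightarrow> ('u \<Rightarrow> 'm) \<Rightarrow> ('u \<Rightarrow> 'm)" where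
  "adjunct P le C \<rho> r M N p =
     (THE \<phi>. \<phi> \<in> nat_trans (poset_cat P le) C (L_fun le C \<rho> r M) N \<and>
       (\<forall>a \<in> P. \<forall>x \<in> down le \<rho> r a.
          \<phi> a \<cdot>\<^bsub>C\<^esub> alpha le C \<rho> r M a x = beta le C \<rho> r N x a \<cdot>\<^bsub>C\<^esub> p x))"

definition eta_L ::
  "'u set \<Rightarrow> 'u rel \<Rightarrow> ('o, 'm) cat \<Rightarrow> ('u \<Rightarrow> 'u \<Rightarrow> ennreal) \<Rightarrow> real
     \<Rightarrow> ('u, 'o, 'm) diagram \<Rightarrow> ('u \<Rightarrow> 'm)" where
  "eta_L P le C \<rho> r M =
     (\<lambda>a \<in> P. THE h. h \<in> hom C (L_obj le C \<rho> r M a) (on_obj M a) \<and>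
       (\<forall>x \<in> down le \<rho> r a. h \<cdot>\<^bsub>C\<^esub> alpha le C \<rho> r M a x = on_arr M (x, a)))"

definition eta_R ::
  "'u set \<Rightarrow> 'u rel \<Rightarrow> ('o, 'm) cat \<Rightarrow> ('u \<Rightarrow> 'u \<Rightarrow> ennreal) \<Rightarrow> real
     \<Rightarrow> ('u, 'o, 'm) diagram \<Rightarrow> ('u \<Rightarrow> 'm)" where
  "eta_R P le C \<rho> r M =
     (\<lambda>a \<in> P. THE h. h \<in> hom C (on_obj M a) (R_obj le C \<rho> r M a) \<and>
       (\<forall>y \<in> up le \<rho> r a. beta le C \<rho> r M a y \<cdot>\<^bsub>C\<^esub> h = on_arr M (a, y)))"

definition e_map ::
  "'u set \<Rightarrow> 'u rel \<Rightarrow> ('o, 'm) cat \<Rightarrow> ('u \<Rightarrow> 'u \<Rightarrow> ennreal) \<Rightarrow> real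
     \<Rightarrow> ('u, 'o, 'm) diagram \<Rightarrow> ('u \<Rightarrow> 'm)" where
  "e_map P le C \<rho> r M = vcomp (poset_cat P le) C (eta_R P le C \<rho> r M) (eta_L P le C \<rho> r M)"


section \<open>The height-interleaving distance\<close>

definition height_interleaved ::
  "'u set \<Rightarrow> 'u rel \<Rightarrow> ('o, 'm) cat \<Rightarrow> ('u \<Rightarrow> 'u \<Rightarrow> ennreal) \<Rightarrow> real
     \<Rightarrow> ('u, 'o, 'm) diagram \<Rightarrow> ('u, 'o, 'm) diagram \<Rightarrow> bool" where
  "height_interleaved P le C \<rho> r M N \<longleftrightarrow>
     (\<exists>p \<in> nat_trans (poset_cat P le) C M (R_fun le C \<rho> r N).
      \<exists>q \<in> nat_trans (poset_cat P le) C N (R_fun le C \<rho> r M).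
        e_map P le C \<rho> r M = vcomp (poset_cat P le) C q (adjunct P le C \<rho> r M N p) \<and>
        e_map P le C \<rho> r N = vcomp (poset_cat P le) C p (adjunct P le C \<rho> r N M q))"

definition height_dist ::
  "'u set \<Rightarrow> 'u rel \<Rightarrow> ('o, 'm) cat \<Rightarrow> ('u \<Rightarrow> 'u \<Rightarrow> ennreal)
     \<Rightarrow> ('u, 'o, 'm) diagram \<Rightarrow> ('u, 'o, 'm) diagram \<Rightarrow> ennreal" where
  "height_dist P le C \<rho> M N =
     Inf {ennreal r | r. 0 \<le> r \<and> height_interleaved P le C \<rho> r M N}"


section \<open>CIP, the intermediate value constant and the distortion\<close>

definition connected_subposet :: "'u rel \<Rightarrow> 'u set \<Rightarrow> bool" where
  "connected_subposet le S \<longleftrightarrow> (\<forall>x \<in> S. \<forall>y \<in> S. (x, y) \<in> ((le \<union> le\<inverse>) \<inter> S \<times> S)\<^sup>*)"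

definition CIP :: "'u set \<Rightarrow> 'u rel \<Rightarrow> ('u \<Rightarrow> 'u \<Rightarrow> ennreal) \<Rightarrow> bool" where
  "CIP P le \<rho> \<longleftrightarrow>
     (\<forall>a \<in> P. \<forall>q \<in> P. \<forall>s \<ge> 0. \<forall>r \<ge> 0.
        down le \<rho> s a \<inter> up le \<rho> r q = {} \<or>
        connected_subposet le (down le \<rho> s a \<inter> up le \<rho> r q))"

definition inf_abs_diff :: "ennreal \<Rightarrow> ennreal \<Rightarrow> ennreal" where
  "inf_abs_diff u v =
     (if u < \<infinity> \<and> v < \<infinity> then ennreal \<bar>enn2real u - enn2real v\<bar>
      else if u = \<infinity> \<and> v = \<infinity> then 0 else \<infinity>)"

text \<open>In \<open>ennreal\<close>, \<open>\<infinity> - t = \<infinity>\<close> for finite \<open>t\<close>; the subtraction below is not truncated since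
  \<open>t \<le> \<rho> a b\<close>.\<close>

definition IV :: "'u set \<Rightarrow> 'u rel \<Rightarrow> ('u \<Rightarrow> 'u \<Rightarrow> ennreal) \<Rightarrow> real \<Rightarrow> bool" where
  "IV P le \<rho> c \<longleftrightarrow>
     (\<forall>a b t. (a, b) \<in> le \<longrightarrow> t < \<infinity> \<longrightarrow> t \<le> \<rho> a b \<longrightarrow>
        (\<exists>z \<in> P. (a, z) \<in> le \<and> (z, b) \<in> le \<and>
           inf_abs_diff (\<rho> a z) t \<le> ennreal (c / 2) \<and>
           inf_abs_diff (\<rho> z b) (\<rho> a b - t) \<le> ennreal (c / 2)))"

definition IV_const :: "'u set \<Rightarrow> 'u rel \<Rightarrow> ('u \<Rightarrow> 'u \<Rightarrow> ennreal) \<Rightarrow> ennreal" where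
  "IV_const P le \<rho> = Inf {ennreal c | c. 0 \<le> c \<and> IV P le \<rho> c}"

definition distortion ::
  "'u rel \<Rightarrow> ('u \<Rightarrow> 'u \<Rightarrow> ennreal) \<Rightarrow> ('u \<Rightarrow> 'u \<Rightarrow> ennreal) \<Rightarrow> ennreal" where
  "distortion le \<rho>\<^sub>1 \<rho>\<^sub>2 =
     Inf {ennreal r | r. 0 \<le> r \<and>
       (\<forall>a b. (a, b) \<in> le \<longrightarrow> inf_abs_diff (\<rho>\<^sub>1 a b) (\<rho>\<^sub>2 a b) \<le> ennreal r)}"

end

theory Submission
  imports Defs
begin

text \<open>By the universal properties, an \<open>r\<close>-height-interleaving of \<open>M\<close> and \<open>N\<close> amounts to two
  families of arrows \<open>M a \<rightarrow> N b\<close> and \<open>N a \<rightarrow> M b\<close>, indexed by the pairs \<open>a \<le> b\<close> with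
  \<open>\<rho> a b \<ge> r\<close>, that absorb structure maps on both sides and whose composites are structure maps.
  In this form an interleaving is transferred between \<open>\<rho>\<^sub>1\<close> and \<open>\<rho>\<^sub>2\<close> by restricting the index
  pairs, at the cost of one \<open>\<delta>\<close>.  With respect to \<open>\<rho>\<^sub>1\<close>, two families are composed through an
  intermediate point \<open>z\<close> of \<open>a \<le> b\<close>: it exists if \<open>\<rho>\<^sub>1 a b\<close> exceeds the sum of the
  two parameters by \<open>c\<close>, and by connectedness of the set of admissible \<open>z\<close> the composite
  does not depend on it.\<close>

section \<open>Interleavings as families of arrows\<close>

text \<open>For a height-difference function the pairs with \<rho> a b at least r form an up-set of
  P^op x P, so the enlarged pairs in the two equations are index pairs automatically. Such a k is a
  compatible family in the sets Hom(M a, N b) over this up-set; its values at all other pairs are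
  left open.\<close>

definition shift_family ::
  "'u rel \<Rightarrow> ('o, 'm) cat \<Rightarrow> ('u \<Rightarrow> 'u \<Rightarrow> ennreal) \<Rightarrow> real
     \<Rightarrow> ('u, 'o, 'm) diagram \<Rightarrow> ('u, 'o, 'm) diagram \<Rightarrow> ('u \<Rightarrow> 'u \<Rightarrow> 'm) \<Rightarrow> bool" where
  "shift_family le C \<rho> r M N k \<longleftrightarrow>
     (\<forall>a b. (a, b) \<in> le \<longrightarrow> ennreal r \<le> \<rho> a b \<longrightarrow> k a b \<in> hom C (on_obj M a) (on_obj N b)) \<and>
     (\<forall>a b b'. (a, b) \<in> le \<longrightarrow> ennreal r \<le> \<rho> a b \<longrightarrow> (b, b') \<in> le \<longrightarrow>
        on_arr N (b, b') \<cdot>\<^bsub>C\<^esub> k a b = k a b') \<and>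
     (\<forall>a' a b. (a', a) \<in> le \<longrightarrow> (a, b) \<in> le \<longrightarrow> ennreal r \<le> \<rho> a b \<longrightarrow>
        k a b \<cdot>\<^bsub>C\<^esub> on_arr M (a', a) = k a' b)"

text \<open>The point a splits x <= y into two index pairs because this is what e_{r,M} at a yields
  when it is tested on the leg \<open>alpha\<close> at x and the leg \<open>beta\<close> at y. Only
  one order of composition is recorded; \<open>shift_interleaved\<close> asks for both.\<close>

definition shift_inverse ::
  "'u rel \<Rightarrow> ('o, 'm) cat \<Rightarrow> ('u \<Rightarrow> 'u \<Rightarrow> ennreal) \<Rightarrow> real
     \<Rightarrow> ('u, 'o, 'm) diagram \<Rightarrow> ('u \<Rightarrow> 'u \<Rightarrow> 'm) \<Rightarrow> ('u \<Rightarrow> 'u \<Rightarrow> 'm) \<Rightarrow> bool" where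
  "shift_inverse le C \<rho> r M l k \<longleftrightarrow>
     (\<forall>x a y. (x, a) \<in> le \<longrightarrow> ennreal r \<le> \<rho> x a \<longrightarrow> (a, y) \<in> le \<longrightarrow> ennreal r \<le> \<rho> a y \<longrightarrow>
        l a y \<cdot>\<^bsub>C\<^esub> k x a = on_arr M (x, y))"

definition shift_interleaved ::
  "'u rel \<Rightarrow> ('o, 'm) cat \<Rightarrow> ('u \<Rightarrow> 'u \<Rightarrow> ennreal) \<Rightarrow> real
     \<Rightarrow> ('u, 'o, 'm) diagram \<Rightarrow> ('u, 'o, 'm) diagram \<Rightarrow> bool" where
  "shift_interleaved le C \<rho> r M N \<longleftrightarrow>
     (\<exists>k l. shift_family le C \<rho> r M N k \<and> shift_family le C \<rho> r N M l \<and>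
        shift_inverse le C \<rho> r M l k \<and> shift_inverse le C \<rho> r N k l)"

lemma shift_familyD:
  assumes "shift_family le C \<rho> r M N k" "(a, b) \<in> le" "ennreal r \<le> \<rho> a b"
  shows "k a b \<in> hom C (on_obj M a) (on_obj N b)"
    and "(b, b') \<in> le \<Longrightarrow> on_arr N (b, b') \<cdot>\<^bsub>C\<^esub> k a b = k a b'"
    and "(a', a) \<in> le \<Longrightarrow> k a b \<cdot>\<^bsub>C\<^esub> on_arr M (a', a) = k a' b"
  using assms unfolding shift_family_def by blast+

lemma shift_family_mono:
  assumes "shift_family le C \<rho> r M N k"
    and "\<And>a b. (a, b) \<in> le \<Longrightarrow> ennreal r' \<le> \<rho>' a b \<Longrightarrow> ennreal r \<le> \<rho> a b"
  shows "shift_family le C \<rho>' r' M N k"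
  using assms(1) unfolding shift_family_def by (intro conjI allI impI) (simp_all add: assms(2))

lemma shift_inverse_mono:
  assumes "shift_inverse le C \<rho> r M l k"
    and "\<And>a b. (a, b) \<in> le \<Longrightarrow> ennreal r' \<le> \<rho>' a b \<Longrightarrow> ennreal r \<le> \<rho> a b"
  shows "shift_inverse le C \<rho>' r' M l k"
  using assms(1) unfolding shift_inverse_def by (simp add: assms(2))

text \<open>The same two families serve: \<rho> and r enter the conditions only through the set of
  index pairs, which the second assumption allows only to shrink. This is the device for changing
  the height-difference function.\<close>

lemma shift_interleaved_mono:
  assumes "shift_interleaved le C \<rho> r M N"
    and "\<And>a b. (a, b) \<in> le \<Longrightarrow> ennreal r' \<le> \<rho>' a b \<Longrightarrow> ennreal r \<le> \<rho> a b"
  shows "shift_interleaved le C \<rho>' r' M N"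
proof -
  from assms(1) obtain k l where "shift_family le C \<rho> r M N k" "shift_family le C \<rho> r N M l"
    "shift_inverse le C \<rho> r M l k" "shift_inverse le C \<rho> r N k l"
    unfolding shift_interleaved_def by blast
  then have "shift_family le C \<rho>' r' M N k" "shift_family le C \<rho>' r' N M l"
    "shift_inverse le C \<rho>' r' M l k" "shift_inverse le C \<rho>' r' N k l"
    by (auto elim!: shift_family_mono shift_inverse_mono intro: assms(2))
  then show ?thesis unfolding shift_interleaved_def by blast
qed

section \<open>Functors, cones and natural transformations on subposets\<close>

lemma functor_arr_hom:
  assumes "is_functor (poset_cat P le) C M" "(a, b) \<in> le" "a \<in> P" "b \<in> P"
  shows "on_arr M (a, b) \<in> hom C (on_obj M a) (on_obj M b)"
proof -
  have "\<forall>f \<in> le \<inter> P \<times> P. on_arr M f \<in> hom C (on_obj M (fst f)) (on_obj M (snd f))"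
    using assms(1) unfolding is_functor_def poset_cat_def by simp
  from bspec[OF this, of "(a, b)"] show ?thesis using assms(2-4) by simp
qed

lemma functor_arr_comp:
  assumes "is_functor (poset_cat P le) C M" "(a, b) \<in> le" "(b, c) \<in> le"
    "a \<in> P" "b \<in> P" "c \<in> P"
  shows "on_arr M (b, c) \<cdot>\<^bsub>C\<^esub> on_arr M (a, b) = on_arr M (a, c)"
proof -
  have "\<forall>f \<in> le \<inter> P \<times> P. \<forall>g \<in> le \<inter> P \<times> P. snd f = fst g \<longrightarrow>
      on_arr M (fst f, snd g) = on_arr M g \<cdot>\<^bsub>C\<^esub> on_arr M f"
    using assms(1) unfolding is_functor_def poset_cat_def by simp
  from bspec[OF bspec[OF this, of "(a, b)"], of "(b, c)"] show ?thesis using assms(2-6) by simp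
qed

lemma functor_obj:
  assumes "is_functor (poset_cat P le) C M" "a \<in> P"
  shows "on_obj M a \<in> Obj C"
  using assms unfolding is_functor_def poset_cat_def by simp

lemma ball_Restr_iff:
  "(\<forall>f \<in> le \<inter> S \<times> S. Q f) \<longleftrightarrow> (\<forall>x y. (x, y) \<in> le \<longrightarrow> x \<in> S \<longrightarrow> y \<in> S \<longrightarrow> Q (x, y))"
  by auto

lemma is_cone_poset_cat:
  "is_cone (poset_cat S le) C D c \<kappa> \<longleftrightarrow>
     c \<in> Obj C \<and> (\<forall>x \<in> S. \<kappa> x \<in> hom C c (on_obj D x)) \<and>
     (\<forall>x y. (x, y) \<in> le \<longrightarrow> x \<in> S \<longrightarrow> y \<in> S \<longrightarrow> on_arr D (x, y) \<cdot>\<^bsub>C\<^esub> \<kappa> x = \<kappa> y)"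
  by (simp add: is_cone_def poset_cat_def ball_Restr_iff)

lemma is_cocone_poset_cat:
  "is_cocone (poset_cat S le) C D c \<kappa> \<longleftrightarrow>
     c \<in> Obj C \<and> (\<forall>x \<in> S. \<kappa> x \<in> hom C (on_obj D x) c) \<and>
     (\<forall>x y. (x, y) \<in> le \<longrightarrow> x \<in> S \<longrightarrow> y \<in> S \<longrightarrow> \<kappa> y \<cdot>\<^bsub>C\<^esub> on_arr D (x, y) = \<kappa> x)"
  by (simp add: is_cocone_def poset_cat_def ball_Restr_iff)

lemma nat_trans_poset_cat:
  "\<phi> \<in> nat_trans (poset_cat P le) C F G \<longleftrightarrow>
     \<phi> \<in> extensional P \<and> (\<forall>a \<in> P. \<phi> a \<in> hom C (on_obj F a) (on_obj G a)) \<and>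
     (\<forall>a b. (a, b) \<in> le \<longrightarrow> a \<in> P \<longrightarrow> b \<in> P \<longrightarrow>
        \<phi> b \<cdot>\<^bsub>C\<^esub> on_arr F (a, b) = on_arr G (a, b) \<cdot>\<^bsub>C\<^esub> \<phi> a)"
  by (simp add: nat_trans_def poset_cat_def ball_Restr_iff)

lemma functor_restrict:
  assumes "is_functor (poset_cat P le) C M" "S \<subseteq> P"
  shows "is_functor (poset_cat S le) C M"
  using assms unfolding is_functor_def poset_cat_def by (simp add: subset_iff) blast

lemma category_poset_cat:
  assumes "partial_order_on P le" "S \<subseteq> P"
  shows "category (poset_cat S le)"
proof -
  have "\<And>a. a \<in> S \<Longrightarrow> (a, a) \<in> le" "trans le"
    using assms by (auto simp: partial_order_on_def preorder_on_def refl_on_def)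
  then show ?thesis
    by unfold_locales (auto simp: poset_cat_def hom_def elim: transE)
qed

lemma is_limit_lim_of:
  assumes "is_limit J C D c \<kappa>"
  shows "is_limit J C D (fst (lim_of J C D)) (snd (lim_of J C D))"
  unfolding lim_of_def using someI[of "\<lambda>(c, \<kappa>). is_limit J C D c \<kappa>" "(c, \<kappa>)"] assms
  by (simp add: case_prod_beta)

lemma is_colimit_colim_of:
  assumes "is_colimit J C D c \<kappa>"
  shows "is_colimit J C D (fst (colim_of J C D)) (snd (colim_of J C D))"
  unfolding colim_of_def using someI[of "\<lambda>(c, \<kappa>). is_colimit J C D c \<kappa>" "(c, \<kappa>)"] assms
  by (simp add: case_prod_beta)

section \<open>Height-difference functions and the universal properties of L_r and R_r\<close>

locale height_poset = category C for C :: "('o, 'm) cat" +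
  fixes P :: "'u set" and le :: "'u rel" and \<rho> :: "'u \<Rightarrow> 'u \<Rightarrow> ennreal"
  assumes complete: "complete_category TYPE('u) C"
    and cocomplete: "cocomplete_category TYPE('u) C"
    and order: "partial_order_on P le"
    and height: "height_difference P le \<rho>"
begin

abbreviation diagram where "diagram M \<equiv> is_functor (poset_cat P le) C M"

lemma le_in: "(a, b) \<in> le \<Longrightarrow> a \<in> P" "(a, b) \<in> le \<Longrightarrow> b \<in> P"
  using order by (auto simp: partial_order_on_def preorder_on_def)

lemma le_refl: "a \<in> P \<Longrightarrow> (a, a) \<in> le"
  using order by (auto simp: partial_order_on_def preorder_on_def refl_on_def)

lemma le_trans: "(a, b) \<in> le \<Longrightarrow> (b, c) \<in> le \<Longrightarrow> (a, c) \<in> le"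
  using order by (auto simp: partial_order_on_def preorder_on_def elim: transE)

text \<open>Superadditivity and nonnegativity: the outer pieces of the interval can only add height.
  All closure properties of \<open>down\<close> and \<open>up\<close> below rest on this.\<close>

lemma height_mono:
  assumes "(a, b) \<in> le" "(b, c) \<in> le" "(c, d) \<in> le"
  shows "\<rho> b c \<le> \<rho> a d"
proof -
  have "\<rho> b c \<le> \<rho> a b + \<rho> b c" "\<rho> a c \<le> \<rho> a c + \<rho> c d" by simp_all
  moreover have "\<rho> a b + \<rho> b c \<le> \<rho> a c" "\<rho> a c + \<rho> c d \<le> \<rho> a d"
    using height assms le_trans unfolding height_difference_def by blast+
  ultimately show ?thesis by (meson order_trans)
qed

lemma arr_hom: "diagram M \<Longrightarrow> (a, b) \<in> le \<Longrightarrow> on_arr M (a, b) \<in> hom C (on_obj M a) (on_obj M b)"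
  using functor_arr_hom le_in by metis

lemma arr_comp: "diagram M \<Longrightarrow> (a, b) \<in> le \<Longrightarrow> (b, c) \<in> le
    \<Longrightarrow> on_arr M (b, c) \<cdot>\<^bsub>C\<^esub> on_arr M (a, b) = on_arr M (a, c)"
  using functor_arr_comp le_in by metis

lemma down_subset: "down le \<rho> r a \<subseteq> P" and up_subset: "up le \<rho> r a \<subseteq> P"
  using le_in by (auto simp: down_def up_def)

lemma down_mono: "x \<in> down le \<rho> r a \<Longrightarrow> (a, b) \<in> le \<Longrightarrow> x \<in> down le \<rho> r b"
  using le_trans height_mono[of x x a b] le_refl le_in order_trans
  unfolding down_def by blast

lemma up_mono: "y \<in> up le \<rho> r b \<Longrightarrow> (a, b) \<in> le \<Longrightarrow> y \<in> up le \<rho> r a"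
  using le_trans height_mono[of a b y y] le_refl le_in order_trans
  unfolding up_def by blast

lemma up_upward: "y \<in> up le \<rho> r a \<Longrightarrow> (y, y') \<in> le \<Longrightarrow> y' \<in> up le \<rho> r a"
  using le_trans height_mono[of a a y y'] le_refl le_in order_trans
  unfolding up_def by blast

lemma down_downward: "x \<in> down le \<rho> r a \<Longrightarrow> (x', x) \<in> le \<Longrightarrow> x' \<in> down le \<rho> r a"
  using le_trans height_mono[of x' x a a] le_refl le_in order_trans
  unfolding down_def by blast

text \<open>A subposet has its objects in \<open>'u\<close> and its arrows in
  \<open>'u \<times> 'u\<close>, so it is one of the diagram shapes covered by
  \<open>complete_category\<close>. Hence a limit exists and the chosen one is a limit.\<close>

lemma R_limit:
  assumes "diagram M"
  shows "is_limit (poset_cat (up le \<rho> r a) le) C M (R_obj le C \<rho> r M a) (beta le C \<rho> r M a)"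
proof -
  have "category (poset_cat (up le \<rho> r a) le)" "is_functor (poset_cat (up le \<rho> r a) le) C M"
    using category_poset_cat[OF order up_subset] functor_restrict[OF assms up_subset] .
  then obtain c \<kappa> where "is_limit (poset_cat (up le \<rho> r a) le) C M c \<kappa>"
    using complete unfolding complete_category_def by blast
  then show ?thesis unfolding R_obj_def beta_def by (rule is_limit_lim_of)
qed

lemma L_colimit:
  assumes "diagram M"
  shows "is_colimit (poset_cat (down le \<rho> r a) le) C M (L_obj le C \<rho> r M a) (alpha le C \<rho> r M a)"
proof -
  have "category (poset_cat (down le \<rho> r a) le)" "is_functor (poset_cat (down le \<rho> r a) le) C M"
    using category_poset_cat[OF order down_subset] functor_restrict[OF assms down_subset] .
  then obtain c \<kappa> where "is_colimit (poset_cat (down le \<rho> r a) le) C M c \<kappa>"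
    using cocomplete unfolding cocomplete_category_def by blast
  then show ?thesis unfolding L_obj_def alpha_def by (rule is_colimit_colim_of)
qed

lemma beta_hom:
  assumes "diagram M" "y \<in> up le \<rho> r a"
  shows "beta le C \<rho> r M a y \<in> hom C (R_obj le C \<rho> r M a) (on_obj M y)"
  using R_limit[OF assms(1), of r a] assms(2)
  unfolding is_limit_def is_cone_poset_cat by simp

lemma alpha_hom:
  assumes "diagram M" "x \<in> down le \<rho> r a"
  shows "alpha le C \<rho> r M a x \<in> hom C (on_obj M x) (L_obj le C \<rho> r M a)"
  using L_colimit[OF assms(1), of r a] assms(2)
  unfolding is_colimit_def is_cocone_poset_cat by simp

lemma R_obj_Obj: "diagram M \<Longrightarrow> R_obj le C \<rho> r M a \<in> Obj C"
  using R_limit[of M r a] unfolding is_limit_def is_cone_def by simp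

lemma L_obj_Obj: "diagram M \<Longrightarrow> L_obj le C \<rho> r M a \<in> Obj C"
  using L_colimit[of M r a] unfolding is_colimit_def is_cocone_def by simp

lemma beta_nat:
  assumes "diagram M" "y \<in> up le \<rho> r a" "(y, y') \<in> le"
  shows "on_arr M (y, y') \<cdot>\<^bsub>C\<^esub> beta le C \<rho> r M a y = beta le C \<rho> r M a y'"
  using R_limit[OF assms(1), of r a] up_upward[OF assms(2,3)] assms(2,3)
  unfolding is_limit_def is_cone_poset_cat by simp

lemma alpha_nat:
  assumes "diagram M" "x \<in> down le \<rho> r a" "(x', x) \<in> le"
  shows "alpha le C \<rho> r M a x \<cdot>\<^bsub>C\<^esub> on_arr M (x', x) = alpha le C \<rho> r M a x'"
  using L_colimit[OF assms(1), of r a] down_downward[OF assms(2,3)] assms(2,3)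
  unfolding is_colimit_def is_cocone_poset_cat by simp

text \<open>In the compatibility assumption y' need only lie above y, since \<open>up\<close> is
  upward closed. This is the form in which \<open>shift_family\<close> supplies cones.\<close>

lemma R_universal:
  assumes "diagram M" "c \<in> Obj C"
    and "\<And>y. y \<in> up le \<rho> r a \<Longrightarrow> k y \<in> hom C c (on_obj M y)"
    and "\<And>y y'. y \<in> up le \<rho> r a \<Longrightarrow> (y, y') \<in> le \<Longrightarrow> on_arr M (y, y') \<cdot>\<^bsub>C\<^esub> k y = k y'"
  shows "\<exists>!h. h \<in> hom C c (R_obj le C \<rho> r M a) \<and>
    (\<forall>y \<in> up le \<rho> r a. beta le C \<rho> r M a y \<cdot>\<^bsub>C\<^esub> h = k y)"
proof -
  have "is_cone (poset_cat (up le \<rho> r a) le) C M c k"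
    using assms(2-4) unfolding is_cone_poset_cat by simp
  with R_limit[OF assms(1), of r a] show ?thesis
    unfolding is_limit_def by (simp add: poset_cat_def)
qed

lemma L_universal:
  assumes "diagram M" "c \<in> Obj C"
    and "\<And>x. x \<in> down le \<rho> r a \<Longrightarrow> k x \<in> hom C (on_obj M x) c"
    and "\<And>x x'. x \<in> down le \<rho> r a \<Longrightarrow> (x', x) \<in> le \<Longrightarrow> k x \<cdot>\<^bsub>C\<^esub> on_arr M (x', x) = k x'"
  shows "\<exists>!h. h \<in> hom C (L_obj le C \<rho> r M a) c \<and>
    (\<forall>x \<in> down le \<rho> r a. h \<cdot>\<^bsub>C\<^esub> alpha le C \<rho> r M a x = k x)"
proof -
  have "is_cocone (poset_cat (down le \<rho> r a) le) C M c k"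
    using assms(2-4) unfolding is_cocone_poset_cat by simp
  with L_colimit[OF assms(1), of r a] show ?thesis
    unfolding is_colimit_def by (simp add: poset_cat_def)
qed

lemma hom_Obj: "f \<in> hom C a b \<Longrightarrow> a \<in> Obj C" "f \<in> hom C a b \<Longrightarrow> b \<in> Obj C"
  using dom_obj cod_obj by (auto simp: hom_def)

text \<open>The legs of a limit are jointly monic: both arrows factor the cone obtained by composing
  the legs with h. Equations between arrows into R_r M are checked in this way throughout, and
  dually those out of L_r M by \<open>L_ext\<close>.\<close>

lemma R_ext:
  assumes M: "diagram M"
    and h: "h \<in> hom C c (R_obj le C \<rho> r M a)" and h': "h' \<in> hom C c (R_obj le C \<rho> r M a)"
    and eq: "\<And>y. y \<in> up le \<rho> r a \<Longrightarrow> beta le C \<rho> r M a y \<cdot>\<^bsub>C\<^esub> h = beta le C \<rho> r M a y \<cdot>\<^bsub>C\<^esub> h'"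
  shows "h = h'"
proof -
  have "\<exists>!g. g \<in> hom C c (R_obj le C \<rho> r M a) \<and>
    (\<forall>y \<in> up le \<rho> r a. beta le C \<rho> r M a y \<cdot>\<^bsub>C\<^esub> g = beta le C \<rho> r M a y \<cdot>\<^bsub>C\<^esub> h)"
  proof (rule R_universal[OF M])
    show "c \<in> Obj C" using h by (rule hom_Obj)
  next
    fix y assume y: "y \<in> up le \<rho> r a"
    show "beta le C \<rho> r M a y \<cdot>\<^bsub>C\<^esub> h \<in> hom C c (on_obj M y)"
      using comp_hom[OF h beta_hom[OF M y]] .
    fix y' assume y': "(y, y') \<in> le"
    show "on_arr M (y, y') \<cdot>\<^bsub>C\<^esub> (beta le C \<rho> r M a y \<cdot>\<^bsub>C\<^esub> h) = beta le C \<rho> r M a y' \<cdot>\<^bsub>C\<^esub> h"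
      using comp_assoc[OF h beta_hom[OF M y] arr_hom[OF M y']] beta_nat[OF M y y'] by simp
  qed
  with h h' eq show ?thesis by metis
qed

lemma L_ext:
  assumes M: "diagram M"
    and h: "h \<in> hom C (L_obj le C \<rho> r M a) c" and h': "h' \<in> hom C (L_obj le C \<rho> r M a) c"
    and eq: "\<And>x. x \<in> down le \<rho> r a \<Longrightarrow> h \<cdot>\<^bsub>C\<^esub> alpha le C \<rho> r M a x = h' \<cdot>\<^bsub>C\<^esub> alpha le C \<rho> r M a x"
  shows "h = h'"
proof -
  have "\<exists>!g. g \<in> hom C (L_obj le C \<rho> r M a) c \<and>
    (\<forall>x \<in> down le \<rho> r a. g \<cdot>\<^bsub>C\<^esub> alpha le C \<rho> r M a x = h \<cdot>\<^bsub>C\<^esub> alpha le C \<rho> r M a x)"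
  proof (rule L_universal[OF M])
    show "c \<in> Obj C" using h by (rule hom_Obj)
  next
    fix x assume x: "x \<in> down le \<rho> r a"
    show "h \<cdot>\<^bsub>C\<^esub> alpha le C \<rho> r M a x \<in> hom C (on_obj M x) c"
      using comp_hom[OF alpha_hom[OF M x] h] .
    fix x' assume x': "(x', x) \<in> le"
    show "(h \<cdot>\<^bsub>C\<^esub> alpha le C \<rho> r M a x) \<cdot>\<^bsub>C\<^esub> on_arr M (x', x) = h \<cdot>\<^bsub>C\<^esub> alpha le C \<rho> r M a x'"
      using comp_assoc[OF arr_hom[OF M x'] alpha_hom[OF M x] h] alpha_nat[OF M x x'] by simp
  qed
  with h h' eq show ?thesis by metis
qed

text \<open>The legs at a restrict to a cone over the smaller set \<open>up le \<rho> r b\<close>,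
  so the definite description in \<open>R_fun\<close> has exactly one solution. The lemmas
  \<open>L_arr\<close>, \<open>eta_R\<close> and \<open>eta_L\<close> do the same for the other
  induced arrows.\<close>

lemma R_arr:
  assumes M: "diagram M" and ab: "(a, b) \<in> le"
  shows "on_arr (R_fun le C \<rho> r M) (a, b) \<in> hom C (R_obj le C \<rho> r M a) (R_obj le C \<rho> r M b) \<and>
    (\<forall>y \<in> up le \<rho> r b.
       beta le C \<rho> r M b y \<cdot>\<^bsub>C\<^esub> on_arr (R_fun le C \<rho> r M) (a, b) = beta le C \<rho> r M a y)"
proof -
  have "\<exists>!h. h \<in> hom C (R_obj le C \<rho> r M a) (R_obj le C \<rho> r M b) \<and>
    (\<forall>y \<in> up le \<rho> r b. beta le C \<rho> r M b y \<cdot>\<^bsub>C\<^esub> h = beta le C \<rho> r M a y)"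
    using R_universal[OF M R_obj_Obj[OF M], of r b "beta le C \<rho> r M a"]
      beta_hom[OF M up_mono[OF _ ab]] beta_nat[OF M up_mono[OF _ ab]] by blast
  from theI'[OF this] show ?thesis unfolding R_fun_def by simp
qed

lemma L_arr:
  assumes M: "diagram M" and ab: "(a, b) \<in> le"
  shows "on_arr (L_fun le C \<rho> r M) (a, b) \<in> hom C (L_obj le C \<rho> r M a) (L_obj le C \<rho> r M b) \<and>
    (\<forall>x \<in> down le \<rho> r a.
       on_arr (L_fun le C \<rho> r M) (a, b) \<cdot>\<^bsub>C\<^esub> alpha le C \<rho> r M a x = alpha le C \<rho> r M b x)"
proof -
  have "\<exists>!h. h \<in> hom C (L_obj le C \<rho> r M a) (L_obj le C \<rho> r M b) \<and>
    (\<forall>x \<in> down le \<rho> r a. h \<cdot>\<^bsub>C\<^esub> alpha le C \<rho> r M a x = alpha le C \<rho> r M b x)"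
    using L_universal[OF M L_obj_Obj[OF M], of r a "alpha le C \<rho> r M b"]
      alpha_hom[OF M down_mono[OF _ ab]] alpha_nat[OF M down_mono[OF _ ab]] by blast
  from theI'[OF this] show ?thesis unfolding L_fun_def by simp
qed

lemma eta_R:
  assumes M: "diagram M" and a: "a \<in> P"
  shows "eta_R P le C \<rho> r M a \<in> hom C (on_obj M a) (R_obj le C \<rho> r M a) \<and>
    (\<forall>y \<in> up le \<rho> r a. beta le C \<rho> r M a y \<cdot>\<^bsub>C\<^esub> eta_R P le C \<rho> r M a = on_arr M (a, y))"
proof -
  have "\<exists>!h. h \<in> hom C (on_obj M a) (R_obj le C \<rho> r M a) \<and>
    (\<forall>y \<in> up le \<rho> r a. beta le C \<rho> r M a y \<cdot>\<^bsub>C\<^esub> h = on_arr M (a, y))"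
    by (rule R_universal[OF M functor_obj[OF M a]])
      (auto simp: up_def intro: arr_hom[OF M] arr_comp[OF M])
  from theI'[OF this] show ?thesis unfolding eta_R_def using a by simp
qed

lemma eta_L:
  assumes M: "diagram M" and a: "a \<in> P"
  shows "eta_L P le C \<rho> r M a \<in> hom C (L_obj le C \<rho> r M a) (on_obj M a) \<and>
    (\<forall>x \<in> down le \<rho> r a. eta_L P le C \<rho> r M a \<cdot>\<^bsub>C\<^esub> alpha le C \<rho> r M a x = on_arr M (x, a))"
proof -
  have "\<exists>!h. h \<in> hom C (L_obj le C \<rho> r M a) (on_obj M a) \<and>
    (\<forall>x \<in> down le \<rho> r a. h \<cdot>\<^bsub>C\<^esub> alpha le C \<rho> r M a x = on_arr M (x, a))"
    by (rule L_universal[OF M functor_obj[OF M a]])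
      (auto simp: down_def intro: arr_hom[OF M] arr_comp[OF M])
  from theI'[OF this] show ?thesis unfolding eta_L_def using a by simp
qed

section \<open>From interleaving morphisms to families of arrows and back\<close>

lemma nat_trans_R_hom:
  assumes "p \<in> nat_trans (poset_cat P le) C M (R_fun le C \<rho> r N)" "a \<in> P"
  shows "p a \<in> hom C (on_obj M a) (R_obj le C \<rho> r N a)"
  using assms by (simp add: nat_trans_poset_cat R_fun_def)

text \<open>Compatibility in b is the cone property of \<open>beta\<close>; compatibility in a is
  naturality of p, read on the leg at b.\<close>

lemma shift_family_of_nat_trans:
  assumes M: "diagram M" and N: "diagram N"
    and p: "p \<in> nat_trans (poset_cat P le) C M (R_fun le C \<rho> r N)"
  shows "shift_family le C \<rho> r M N (\<lambda>a b. beta le C \<rho> r N a b \<cdot>\<^bsub>C\<^esub> p a)"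
  unfolding shift_family_def
proof (intro conjI allI impI)
  fix a b assume ab: "(a, b) \<in> le" "ennreal r \<le> \<rho> a b"
  then have b: "b \<in> up le \<rho> r a" and a: "a \<in> P" using le_in by (auto simp: up_def)
  note pa = nat_trans_R_hom[OF p a]
  show "beta le C \<rho> r N a b \<cdot>\<^bsub>C\<^esub> p a \<in> hom C (on_obj M a) (on_obj N b)"
    using comp_hom[OF pa beta_hom[OF N b]] .
  show "on_arr N (b, b') \<cdot>\<^bsub>C\<^esub> (beta le C \<rho> r N a b \<cdot>\<^bsub>C\<^esub> p a) = beta le C \<rho> r N a b' \<cdot>\<^bsub>C\<^esub> p a"
    if "(b, b') \<in> le" for b'
    using comp_assoc[OF pa beta_hom[OF N b] arr_hom[OF N that]] beta_nat[OF N b that] by simp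
  fix a' assume a': "(a', a) \<in> le"
  note pa' = nat_trans_R_hom[OF p le_in(1)[OF a']]
  have nat: "p a \<cdot>\<^bsub>C\<^esub> on_arr M (a', a) = on_arr (R_fun le C \<rho> r N) (a', a) \<cdot>\<^bsub>C\<^esub> p a'"
    using p a' le_in[OF a'] unfolding nat_trans_poset_cat by blast
  show "(beta le C \<rho> r N a b \<cdot>\<^bsub>C\<^esub> p a) \<cdot>\<^bsub>C\<^esub> on_arr M (a', a) = beta le C \<rho> r N a' b \<cdot>\<^bsub>C\<^esub> p a'"
    using comp_assoc[OF arr_hom[OF M a'] pa beta_hom[OF N b]]
      comp_assoc[OF pa' _ beta_hom[OF N b]] nat R_arr[OF N a', of r] b by metis
qed

text \<open>For fixed a the arrows k a y form a cone over \<open>up le \<rho> r a\<close>, and the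
  component of p at a is the arrow it induces into the limit. Naturality is checked on the legs,
  where both sides become k a y.\<close>

lemma nat_trans_of_shift_family:
  assumes M: "diagram M" and N: "diagram N" and k: "shift_family le C \<rho> r M N k"
  shows "\<exists>p \<in> nat_trans (poset_cat P le) C M (R_fun le C \<rho> r N).
    \<forall>a b. (a, b) \<in> le \<longrightarrow> ennreal r \<le> \<rho> a b \<longrightarrow> beta le C \<rho> r N a b \<cdot>\<^bsub>C\<^esub> p a = k a b"
proof -
  note kD = shift_familyD[OF k]
  have ex: "\<exists>h. h \<in> hom C (on_obj M a) (R_obj le C \<rho> r N a) \<and>
    (\<forall>y \<in> up le \<rho> r a. beta le C \<rho> r N a y \<cdot>\<^bsub>C\<^esub> h = k a y)" if a: "a \<in> P" for a
    by (rule ex1_implies_ex, rule R_universal[OF N functor_obj[OF M a]])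
      (use kD(1,2) in \<open>auto simp: up_def\<close>)
  define h where "h a = (SOME h. h \<in> hom C (on_obj M a) (R_obj le C \<rho> r N a) \<and>
    (\<forall>y \<in> up le \<rho> r a. beta le C \<rho> r N a y \<cdot>\<^bsub>C\<^esub> h = k a y))" for a
  have hom: "h a \<in> hom C (on_obj M a) (R_obj le C \<rho> r N a)"
    and beta: "y \<in> up le \<rho> r a \<Longrightarrow> beta le C \<rho> r N a y \<cdot>\<^bsub>C\<^esub> h a = k a y" if "a \<in> P" for a y
    using someI_ex[OF ex[OF that]] unfolding h_def by blast+
  have nat: "h b \<cdot>\<^bsub>C\<^esub> on_arr M (a, b) = on_arr (R_fun le C \<rho> r N) (a, b) \<cdot>\<^bsub>C\<^esub> h a"
    if ab: "(a, b) \<in> le" for a b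
  proof (rule R_ext[OF N])
    note P = le_in[OF ab]
    have Rab: "on_arr (R_fun le C \<rho> r N) (a, b) \<in> hom C (R_obj le C \<rho> r N a) (R_obj le C \<rho> r N b)"
      using R_arr[OF N ab] by blast
    show "h b \<cdot>\<^bsub>C\<^esub> on_arr M (a, b) \<in> hom C (on_obj M a) (R_obj le C \<rho> r N b)"
      using comp_hom[OF arr_hom[OF M ab] hom[OF P(2)]] .
    show "on_arr (R_fun le C \<rho> r N) (a, b) \<cdot>\<^bsub>C\<^esub> h a \<in> hom C (on_obj M a) (R_obj le C \<rho> r N b)"
      using comp_hom[OF hom[OF P(1)] Rab] .
    fix y assume y: "y \<in> up le \<rho> r b"
    have "beta le C \<rho> r N b y \<cdot>\<^bsub>C\<^esub> (h b \<cdot>\<^bsub>C\<^esub> on_arr M (a, b)) = k b y \<cdot>\<^bsub>C\<^esub> on_arr M (a, b)"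
      using comp_assoc[OF arr_hom[OF M ab] hom[OF P(2)] beta_hom[OF N y]] beta[OF P(2) y] by simp
    also have "\<dots> = k a y" using kD(3) y ab by (simp add: up_def)
    also have "\<dots> = beta le C \<rho> r N a y \<cdot>\<^bsub>C\<^esub> h a" using beta[OF P(1) up_mono[OF y ab]] by simp
    also have "\<dots> = beta le C \<rho> r N b y \<cdot>\<^bsub>C\<^esub> (on_arr (R_fun le C \<rho> r N) (a, b) \<cdot>\<^bsub>C\<^esub> h a)"
      using comp_assoc[OF hom[OF P(1)] Rab beta_hom[OF N y]] R_arr[OF N ab, of r] y by simp
    finally show "beta le C \<rho> r N b y \<cdot>\<^bsub>C\<^esub> (h b \<cdot>\<^bsub>C\<^esub> on_arr M (a, b)) =
      beta le C \<rho> r N b y \<cdot>\<^bsub>C\<^esub> (on_arr (R_fun le C \<rho> r N) (a, b) \<cdot>\<^bsub>C\<^esub> h a)" .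
  qed
  \<comment> \<open>Membership in \<open>nat_trans\<close> includes extensionality, so the values of
    h outside P are cut off.\<close>
  have "restrict h P \<in> nat_trans (poset_cat P le) C M (R_fun le C \<rho> r N)"
    using hom nat by (simp add: nat_trans_poset_cat R_fun_def)
  moreover have "\<forall>a b. (a, b) \<in> le \<longrightarrow> ennreal r \<le> \<rho> a b \<longrightarrow>
      beta le C \<rho> r N a b \<cdot>\<^bsub>C\<^esub> restrict h P a = k a b"
    using beta le_in by (simp add: up_def)
  ultimately show ?thesis by blast
qed

text \<open>The same family also glues in its first variable: for fixed a the arrows ?k x a form a
  cocone over \<open>down le \<rho> r a\<close> and induce an arrow out of the colimit. Uniqueness
  holds pointwise by \<open>L_ext\<close> on P and by extensionality elsewhere, so the definite
  description in \<open>adjunct\<close> denotes.\<close>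

lemma adjunct:
  assumes M: "diagram M" and N: "diagram N"
    and p: "p \<in> nat_trans (poset_cat P le) C M (R_fun le C \<rho> r N)"
  shows "adjunct P le C \<rho> r M N p \<in> nat_trans (poset_cat P le) C (L_fun le C \<rho> r M) N \<and>
    (\<forall>a \<in> P. \<forall>x \<in> down le \<rho> r a. adjunct P le C \<rho> r M N p a \<cdot>\<^bsub>C\<^esub> alpha le C \<rho> r M a x =
      beta le C \<rho> r N x a \<cdot>\<^bsub>C\<^esub> p x)"
proof -
  let ?k = "\<lambda>x a. beta le C \<rho> r N x a \<cdot>\<^bsub>C\<^esub> p x"
  note kD = shift_familyD[OF shift_family_of_nat_trans[OF M N p]]
  have ex: "\<exists>h. h \<in> hom C (L_obj le C \<rho> r M a) (on_obj N a) \<and>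
    (\<forall>x \<in> down le \<rho> r a. h \<cdot>\<^bsub>C\<^esub> alpha le C \<rho> r M a x = ?k x a)" if a: "a \<in> P" for a
    by (rule ex1_implies_ex, rule L_universal[OF M functor_obj[OF N a]])
      (use kD(1,3) in \<open>auto simp: down_def\<close>)
  define h where "h a = (SOME h. h \<in> hom C (L_obj le C \<rho> r M a) (on_obj N a) \<and>
    (\<forall>x \<in> down le \<rho> r a. h \<cdot>\<^bsub>C\<^esub> alpha le C \<rho> r M a x = ?k x a))" for a
  have hom: "h a \<in> hom C (L_obj le C \<rho> r M a) (on_obj N a)"
    and alpha: "x \<in> down le \<rho> r a \<Longrightarrow> h a \<cdot>\<^bsub>C\<^esub> alpha le C \<rho> r M a x = ?k x a" if "a \<in> P" for a x
    using someI_ex[OF ex[OF that]] unfolding h_def by blast+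
  have nat: "h b \<cdot>\<^bsub>C\<^esub> on_arr (L_fun le C \<rho> r M) (a, b) = on_arr N (a, b) \<cdot>\<^bsub>C\<^esub> h a"
    if ab: "(a, b) \<in> le" for a b
  proof (rule L_ext[OF M])
    note P = le_in[OF ab]
    have Lab: "on_arr (L_fun le C \<rho> r M) (a, b) \<in> hom C (L_obj le C \<rho> r M a) (L_obj le C \<rho> r M b)"
      using L_arr[OF M ab] by blast
    show "h b \<cdot>\<^bsub>C\<^esub> on_arr (L_fun le C \<rho> r M) (a, b) \<in> hom C (L_obj le C \<rho> r M a) (on_obj N b)"
      using comp_hom[OF Lab hom[OF P(2)]] .
    show "on_arr N (a, b) \<cdot>\<^bsub>C\<^esub> h a \<in> hom C (L_obj le C \<rho> r M a) (on_obj N b)"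
      using comp_hom[OF hom[OF P(1)] arr_hom[OF N ab]] .
    fix x assume x: "x \<in> down le \<rho> r a"
    have "(h b \<cdot>\<^bsub>C\<^esub> on_arr (L_fun le C \<rho> r M) (a, b)) \<cdot>\<^bsub>C\<^esub> alpha le C \<rho> r M a x = ?k x b"
      using comp_assoc[OF alpha_hom[OF M x] Lab hom[OF P(2)]] L_arr[OF M ab, of r] x
        alpha[OF P(2) down_mono[OF x ab]] by simp
    also have "\<dots> = on_arr N (a, b) \<cdot>\<^bsub>C\<^esub> ?k x a" using kD(2) x ab by (simp add: down_def)
    also have "\<dots> = (on_arr N (a, b) \<cdot>\<^bsub>C\<^esub> h a) \<cdot>\<^bsub>C\<^esub> alpha le C \<rho> r M a x"
      using comp_assoc[OF alpha_hom[OF M x] hom[OF P(1)] arr_hom[OF N ab]] alpha[OF P(1) x] by simp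
    finally show "(h b \<cdot>\<^bsub>C\<^esub> on_arr (L_fun le C \<rho> r M) (a, b)) \<cdot>\<^bsub>C\<^esub> alpha le C \<rho> r M a x =
      (on_arr N (a, b) \<cdot>\<^bsub>C\<^esub> h a) \<cdot>\<^bsub>C\<^esub> alpha le C \<rho> r M a x" .
  qed
  let ?Q = "\<lambda>\<phi>. \<phi> \<in> nat_trans (poset_cat P le) C (L_fun le C \<rho> r M) N \<and>
    (\<forall>a \<in> P. \<forall>x \<in> down le \<rho> r a. \<phi> a \<cdot>\<^bsub>C\<^esub> alpha le C \<rho> r M a x = ?k x a)"
  have "\<exists>!\<phi>. ?Q \<phi>"
  proof (rule ex1I[of _ "restrict h P"])
    show "?Q (restrict h P)"
      using hom nat alpha by (simp add: nat_trans_poset_cat L_fun_def)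
  next
    fix \<phi> assume \<phi>: "?Q \<phi>"
    then have ext: "\<phi> \<in> extensional P"
      and hom': "\<And>a. a \<in> P \<Longrightarrow> \<phi> a \<in> hom C (L_obj le C \<rho> r M a) (on_obj N a)"
      by (simp_all add: nat_trans_poset_cat L_fun_def)
    show "\<phi> = restrict h P"
    proof (rule extensionalityI[OF ext restrict_extensional])
      fix a assume a: "a \<in> P"
      have "\<phi> a = h a" by (rule L_ext[OF M hom'[OF a] hom[OF a]]) (use \<phi> alpha a in simp)
      then show "\<phi> a = restrict h P a" using a by simp
    qed
  qed
  from theI'[OF this] show ?thesis unfolding adjunct_def .
qed

text \<open>An arrow from a colimit to a limit is determined by its matrix of composites with an
  \<open>alpha\<close> leg before and a \<open>beta\<close> leg after. At (x, y) the matrix of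
  \<open>e_map\<close> has the structure map of x <= y, and that of the other side has the composite
  of the two families through a.\<close>

lemma e_map_eq_iff_shift_inverse:
  assumes M: "diagram M" and N: "diagram N"
    and p: "p \<in> nat_trans (poset_cat P le) C M (R_fun le C \<rho> r N)"
    and q: "q \<in> nat_trans (poset_cat P le) C N (R_fun le C \<rho> r M)"
  shows "e_map P le C \<rho> r M = vcomp (poset_cat P le) C q (adjunct P le C \<rho> r M N p) \<longleftrightarrow>
    shift_inverse le C \<rho> r M (\<lambda>a b. beta le C \<rho> r M a b \<cdot>\<^bsub>C\<^esub> q a)
      (\<lambda>a b. beta le C \<rho> r N a b \<cdot>\<^bsub>C\<^esub> p a)"
proof -
  let ?e = "\<lambda>a. eta_R P le C \<rho> r M a \<cdot>\<^bsub>C\<^esub> eta_L P le C \<rho> r M a"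
  let ?f = "\<lambda>a. q a \<cdot>\<^bsub>C\<^esub> adjunct P le C \<rho> r M N p a"
  let ?l = "\<lambda>a b. beta le C \<rho> r M a b \<cdot>\<^bsub>C\<^esub> q a"
  let ?k = "\<lambda>a b. beta le C \<rho> r N a b \<cdot>\<^bsub>C\<^esub> p a"
  have e_hom: "?e a \<in> hom C (L_obj le C \<rho> r M a) (R_obj le C \<rho> r M a)" if "a \<in> P" for a
    using comp_hom eta_L[OF M that] eta_R[OF M that] by blast
  have adj_hom: "adjunct P le C \<rho> r M N p a \<in> hom C (L_obj le C \<rho> r M a) (on_obj N a)"
    if "a \<in> P" for a
    using adjunct[OF M N p] that by (simp_all add: nat_trans_poset_cat L_fun_def)
  have f_hom: "?f a \<in> hom C (L_obj le C \<rho> r M a) (R_obj le C \<rho> r M a)" if "a \<in> P" for a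
    using comp_hom[OF adj_hom[OF that] nat_trans_R_hom[OF q that]] .
  have sandwich: "(beta le C \<rho> r M a y \<cdot>\<^bsub>C\<^esub> (g \<cdot>\<^bsub>C\<^esub> f)) \<cdot>\<^bsub>C\<^esub> alpha le C \<rho> r M a x =
      (beta le C \<rho> r M a y \<cdot>\<^bsub>C\<^esub> g) \<cdot>\<^bsub>C\<^esub> (f \<cdot>\<^bsub>C\<^esub> alpha le C \<rho> r M a x)"
    if x: "x \<in> down le \<rho> r a" and y: "y \<in> up le \<rho> r a"
      and f: "f \<in> hom C (L_obj le C \<rho> r M a) c" and g: "g \<in> hom C c (R_obj le C \<rho> r M a)"
    for a x y f g c
    using comp_assoc[OF f g beta_hom[OF M y]]
      comp_assoc[OF alpha_hom[OF M x] f comp_hom[OF g beta_hom[OF M y]]] by simp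
  have e_eq: "(beta le C \<rho> r M a y \<cdot>\<^bsub>C\<^esub> ?e a) \<cdot>\<^bsub>C\<^esub> alpha le C \<rho> r M a x = on_arr M (x, y)"
    if a: "a \<in> P" and x: "x \<in> down le \<rho> r a" and y: "y \<in> up le \<rho> r a" for a x y
  proof -
    have L: "eta_L P le C \<rho> r M a \<in> hom C (L_obj le C \<rho> r M a) (on_obj M a)"
      and R: "eta_R P le C \<rho> r M a \<in> hom C (on_obj M a) (R_obj le C \<rho> r M a)"
      using eta_L[OF M a] eta_R[OF M a] by blast+
    have "(x, a) \<in> le" "(a, y) \<in> le" using x y by (auto simp: down_def up_def)
    then show ?thesis
      using sandwich[OF x y L R] eta_L[OF M a, of r] eta_R[OF M a, of r] x y arr_comp[OF M] by simp
  qed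
  have f_eq: "(beta le C \<rho> r M a y \<cdot>\<^bsub>C\<^esub> ?f a) \<cdot>\<^bsub>C\<^esub> alpha le C \<rho> r M a x = ?l a y \<cdot>\<^bsub>C\<^esub> ?k x a"
    if a: "a \<in> P" and x: "x \<in> down le \<rho> r a" and y: "y \<in> up le \<rho> r a" for a x y
    using sandwich[OF x y adj_hom[OF a] nat_trans_R_hom[OF q a]] adjunct[OF M N p] a x by simp
  \<comment> \<open>Both sides are values of \<open>vcomp\<close>, hence agree outside P by
    definition.\<close>
  have "e_map P le C \<rho> r M = vcomp (poset_cat P le) C q (adjunct P le C \<rho> r M N p)
      \<longleftrightarrow> (\<forall>a \<in> P. ?e a = ?f a)"
    unfolding e_map_def vcomp_def
    by (auto simp: poset_cat_def restrict_def fun_eq_iff)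
  also have "\<dots> \<longleftrightarrow> (\<forall>a \<in> P. \<forall>x \<in> down le \<rho> r a. \<forall>y \<in> up le \<rho> r a.
      on_arr M (x, y) = ?l a y \<cdot>\<^bsub>C\<^esub> ?k x a)"
  proof (intro ball_cong refl iffI ballI)
    fix a x y assume a: "a \<in> P" and x: "x \<in> down le \<rho> r a" and y: "y \<in> up le \<rho> r a"
      and "?e a = ?f a"
    then show "on_arr M (x, y) = ?l a y \<cdot>\<^bsub>C\<^esub> ?k x a" using e_eq[OF a x y] f_eq[OF a x y] by metis
  next
    fix a assume a: "a \<in> P"
      and eq: "\<forall>x \<in> down le \<rho> r a. \<forall>y \<in> up le \<rho> r a. on_arr M (x, y) = ?l a y \<cdot>\<^bsub>C\<^esub> ?k x a"
    show "?e a = ?f a"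
    \<comment> \<open>The matrix entries determine the arrow: first the \<open>beta\<close> legs are
      cancelled, then the \<open>alpha\<close> legs.\<close>
    proof (rule R_ext[OF M e_hom[OF a] f_hom[OF a]])
      fix y assume y: "y \<in> up le \<rho> r a"
      show "beta le C \<rho> r M a y \<cdot>\<^bsub>C\<^esub> ?e a = beta le C \<rho> r M a y \<cdot>\<^bsub>C\<^esub> ?f a"
        by (rule L_ext[OF M comp_hom[OF e_hom[OF a] beta_hom[OF M y]]
              comp_hom[OF f_hom[OF a] beta_hom[OF M y]]])
          (use e_eq[OF a _ y] f_eq[OF a _ y] eq y in simp)
    qed
  qed
  also have "\<dots> \<longleftrightarrow> shift_inverse le C \<rho> r M ?l ?k"
    unfolding shift_inverse_def down_def up_def using le_in by (auto; metis)
  finally show ?thesis .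
qed

text \<open>\<open>nat_trans_of_shift_family\<close> recovers a given family on index pairs only;
  the inverse condition looks at no other pairs.\<close>

lemma shift_inverse_cong:
  assumes "\<And>a b. (a, b) \<in> le \<Longrightarrow> ennreal r \<le> \<rho> a b \<Longrightarrow> k a b = k' a b"
    and "\<And>a b. (a, b) \<in> le \<Longrightarrow> ennreal r \<le> \<rho> a b \<Longrightarrow> l a b = l' a b"
  shows "shift_inverse le C \<rho> r M l k \<longleftrightarrow> shift_inverse le C \<rho> r M l' k'"
  using assms unfolding shift_inverse_def by auto

text \<open>This removes limits and colimits from the relation. On the right-hand side \<rho> and r
  matter only through the index pairs, so interleavings for different height-difference functions
  become comparable.\<close>

theorem height_interleaved_iff:
  assumes M: "diagram M" and N: "diagram N"
  shows "height_interleaved P le C \<rho> r M N \<longleftrightarrow> shift_interleaved le C \<rho> r M N"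
proof
  assume "height_interleaved P le C \<rho> r M N"
  then obtain p q where p: "p \<in> nat_trans (poset_cat P le) C M (R_fun le C \<rho> r N)"
    and q: "q \<in> nat_trans (poset_cat P le) C N (R_fun le C \<rho> r M)"
    and eq: "e_map P le C \<rho> r M = vcomp (poset_cat P le) C q (adjunct P le C \<rho> r M N p)"
      "e_map P le C \<rho> r N = vcomp (poset_cat P le) C p (adjunct P le C \<rho> r N M q)"
    unfolding height_interleaved_def by blast
  show "shift_interleaved le C \<rho> r M N"
    unfolding shift_interleaved_def
    using shift_family_of_nat_trans[OF M N p] shift_family_of_nat_trans[OF N M q]
      e_map_eq_iff_shift_inverse[OF M N p q] e_map_eq_iff_shift_inverse[OF N M q p] eq by blast
next
  assume "shift_interleaved le C \<rho> r M N"
  then obtain k l where k: "shift_family le C \<rho> r M N k" and l: "shift_family le C \<rho> r N M l"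
    and inv: "shift_inverse le C \<rho> r M l k" "shift_inverse le C \<rho> r N k l"
    unfolding shift_interleaved_def by blast
  from nat_trans_of_shift_family[OF M N k] nat_trans_of_shift_family[OF N M l]
  obtain p q where p: "p \<in> nat_trans (poset_cat P le) C M (R_fun le C \<rho> r N)"
    and q: "q \<in> nat_trans (poset_cat P le) C N (R_fun le C \<rho> r M)"
    and pk: "\<And>a b. (a, b) \<in> le \<Longrightarrow> ennreal r \<le> \<rho> a b \<Longrightarrow> beta le C \<rho> r N a b \<cdot>\<^bsub>C\<^esub> p a = k a b"
    and ql: "\<And>a b. (a, b) \<in> le \<Longrightarrow> ennreal r \<le> \<rho> a b \<Longrightarrow> beta le C \<rho> r M a b \<cdot>\<^bsub>C\<^esub> q a = l a b"
    by blast
  let ?k = "\<lambda>a b. beta le C \<rho> r N a b \<cdot>\<^bsub>C\<^esub> p a" and ?l = "\<lambda>a b. beta le C \<rho> r M a b \<cdot>\<^bsub>C\<^esub> q a"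
  have "shift_inverse le C \<rho> r M ?l ?k" "shift_inverse le C \<rho> r N ?k ?l"
    using shift_inverse_cong[of r ?k k ?l l M] shift_inverse_cong[of r ?l l ?k k N] pk ql inv by simp_all
  then show "height_interleaved P le C \<rho> r M N"
    unfolding height_interleaved_def
    using p q e_map_eq_iff_shift_inverse[OF M N p q] e_map_eq_iff_shift_inverse[OF N M q p] by blast
qed

section \<open>Composition through intermediate points\<close>

text \<open>For admissible u <= v both composites equal k' v b after X(u <= v) after k a u, since
  either family absorbs the structure map. CIP joins z to z' by a zigzag of such
  comparisons.\<close>

lemma comp_shift_eq:
  assumes X: "diagram X"
    and k: "shift_family le C \<rho> s M X k" and k': "shift_family le C \<rho> t X N k'"
    and CIP: "CIP P le \<rho>" and st: "0 \<le> s" "0 \<le> t" and ab: "(a, b) \<in> le"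
    and z: "z \<in> down le \<rho> t b \<inter> up le \<rho> s a" and z': "z' \<in> down le \<rho> t b \<inter> up le \<rho> s a"
  shows "k' z b \<cdot>\<^bsub>C\<^esub> k a z = k' z' b \<cdot>\<^bsub>C\<^esub> k a z'"
proof -
  let ?I = "down le \<rho> t b \<inter> up le \<rho> s a"
  note kD = shift_familyD[OF k] and k'D = shift_familyD[OF k']
  have comparable: "k' u b \<cdot>\<^bsub>C\<^esub> k a u = k' v b \<cdot>\<^bsub>C\<^esub> k a v"
    if uv: "(u, v) \<in> le" and u: "u \<in> ?I" and v: "v \<in> ?I" for u v
    using comp_assoc[OF kD(1) arr_hom[OF X uv] k'D(1), of a b] kD(2)[of a u v] k'D(3)[of v b u]
      uv u v
    by (simp add: down_def up_def)
  have "(z, z') \<in> ((le \<union> le\<inverse>) \<inter> ?I \<times> ?I)\<^sup>*"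
    using CIP z z' le_in[OF ab] st unfolding CIP_def connected_subposet_def by blast
  then show ?thesis
  proof (induction rule: rtrancl_induct)
    case (step u v)
    then have "u \<in> ?I" "v \<in> ?I" "(u, v) \<in> le \<or> (v, u) \<in> le" by auto
    then have "k' u b \<cdot>\<^bsub>C\<^esub> k a u = k' v b \<cdot>\<^bsub>C\<^esub> k a v" using comparable by metis
    with step.IH show ?case by simp
  qed simp
qed

text \<open>An intermediate point of (a, b) is also one of (a, b') and of (a', b). Independence of
  the chosen point therefore lets both sides of each compatibility equation be computed with the
  same z.\<close>

lemma comp_shift_family:
  assumes M: "diagram M" and X: "diagram X" and N: "diagram N"
    and k: "shift_family le C \<rho> s M X k" and k': "shift_family le C \<rho> t X N k'"
    and CIP: "CIP P le \<rho>" and st: "0 \<le> s" "0 \<le> t"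
    and mid: "\<And>a b. (a, b) \<in> le \<Longrightarrow> ennreal u \<le> \<rho> a b \<Longrightarrow> down le \<rho> t b \<inter> up le \<rho> s a \<noteq> {}"
  obtains g where "shift_family le C \<rho> u M N g"
    and "\<And>a b z. (a, b) \<in> le \<Longrightarrow> z \<in> down le \<rho> t b \<inter> up le \<rho> s a \<Longrightarrow> g a b = k' z b \<cdot>\<^bsub>C\<^esub> k a z"
proof
  \<comment> \<open>Where no admissible z exists the value is arbitrary; by \<open>mid\<close> this
    happens at no index pair of the new family.\<close>
  define g where "g a b = (let z = (SOME z. z \<in> down le \<rho> t b \<inter> up le \<rho> s a) in k' z b \<cdot>\<^bsub>C\<^esub> k a z)"
    for a b
  show g: "g a b = k' z b \<cdot>\<^bsub>C\<^esub> k a z"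
    if "(a, b) \<in> le" and z: "z \<in> down le \<rho> t b \<inter> up le \<rho> s a" for a b z
    unfolding g_def Let_def
    by (rule comp_shift_eq[OF X k k' CIP st that(1) someI z]) (rule z)
  note kD = shift_familyD[OF k] and k'D = shift_familyD[OF k']
  show "shift_family le C \<rho> u M N g"
    unfolding shift_family_def
  proof (intro conjI allI impI)
    fix a b assume ab: "(a, b) \<in> le" "ennreal u \<le> \<rho> a b"
    from mid[OF ab] obtain z where z: "z \<in> down le \<rho> t b \<inter> up le \<rho> s a" by blast
    then have az: "(a, z) \<in> le" "ennreal s \<le> \<rho> a z" and zb: "(z, b) \<in> le" "ennreal t \<le> \<rho> z b"
      by (auto simp: down_def up_def)
    note gab = g[OF ab(1) z]
    show "g a b \<in> hom C (on_obj M a) (on_obj N b)"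
      unfolding gab using comp_hom[OF kD(1)[OF az] k'D(1)[OF zb]] .
    show "on_arr N (b, b') \<cdot>\<^bsub>C\<^esub> g a b = g a b'" if b': "(b, b') \<in> le" for b'
    proof -
      have "z \<in> down le \<rho> t b' \<inter> up le \<rho> s a" using z down_mono[OF _ b'] by blast
      with gab g[OF le_trans[OF ab(1) b']] show ?thesis
        using comp_assoc[OF kD(1)[OF az] k'D(1)[OF zb] arr_hom[OF N b']] k'D(2)[OF zb b'] by simp
    qed
    show "g a b \<cdot>\<^bsub>C\<^esub> on_arr M (a', a) = g a' b" if a': "(a', a) \<in> le" for a'
    proof -
      have "z \<in> down le \<rho> t b \<inter> up le \<rho> s a'" using z up_mono[OF _ a'] by blast
      with gab g[OF le_trans[OF a' ab(1)]] show ?thesis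
        using comp_assoc[OF arr_hom[OF M a'] kD(1)[OF az] k'D(1)[OF zb]] kD(3)[OF az a'] by simp
    qed
  qed
qed

text \<open>The fourfold composite collapses from the inside: the two arrows meeting at a become X(z
  <= w), which k absorbs, and what remains is a composite of l and k through w.\<close>

lemma comp_shift_inverse:
  assumes X: "diagram X"
    and k: "shift_family le C \<rho> s M X k" and l: "shift_family le C \<rho> s X M l"
    and k': "shift_family le C \<rho> t X N k'" and l': "shift_family le C \<rho> t N X l'"
    and lk: "shift_inverse le C \<rho> s M l k" and lk': "shift_inverse le C \<rho> t X l' k'"
    and mid: "\<And>a b. (a, b) \<in> le \<Longrightarrow> ennreal u \<le> \<rho> a b \<Longrightarrow> down le \<rho> t b \<inter> up le \<rho> s a \<noteq> {}"
    and mid': "\<And>a b. (a, b) \<in> le \<Longrightarrow> ennreal u \<le> \<rho> a b \<Longrightarrow> down le \<rho> s b \<inter> up le \<rho> t a \<noteq> {}"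
    and g: "\<And>a b z. (a, b) \<in> le \<Longrightarrow> z \<in> down le \<rho> t b \<inter> up le \<rho> s a \<Longrightarrow> g a b = k' z b \<cdot>\<^bsub>C\<^esub> k a z"
    and h: "\<And>a b z. (a, b) \<in> le \<Longrightarrow> z \<in> down le \<rho> s b \<inter> up le \<rho> t a \<Longrightarrow> h a b = l z b \<cdot>\<^bsub>C\<^esub> l' a z"
  shows "shift_inverse le C \<rho> u M h g"
  unfolding shift_inverse_def
proof (intro allI impI)
  fix x a y assume xa: "(x, a) \<in> le" "ennreal u \<le> \<rho> x a" and ay: "(a, y) \<in> le" "ennreal u \<le> \<rho> a y"
  from mid[OF xa] obtain z where z: "z \<in> down le \<rho> t a \<inter> up le \<rho> s x" by blast
  from mid'[OF ay] obtain w where w: "w \<in> down le \<rho> s y \<inter> up le \<rho> t a" by blast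
  have xz: "(x, z) \<in> le" "ennreal s \<le> \<rho> x z" and za: "(z, a) \<in> le" "ennreal t \<le> \<rho> z a"
    and aw: "(a, w) \<in> le" "ennreal t \<le> \<rho> a w" and wy: "(w, y) \<in> le" "ennreal s \<le> \<rho> w y"
    using z w by (auto simp: down_def up_def)
  have zw: "(z, w) \<in> le" using le_trans[OF za(1) aw(1)] .
  \<comment> \<open>With this, w splits x <= y into two index pairs for s, as the inverse law for l
    and k requires.\<close>
  have xw: "w \<in> up le \<rho> s x" using up_upward[OF _ zw] z by blast
  note K = shift_familyD(1)[OF k xz] and K' = shift_familyD(1)[OF k' za]
    and L' = shift_familyD(1)[OF l' aw] and L = shift_familyD(1)[OF l wy]
  have "h a y \<cdot>\<^bsub>C\<^esub> g x a = (l w y \<cdot>\<^bsub>C\<^esub> l' a w) \<cdot>\<^bsub>C\<^esub> (k' z a \<cdot>\<^bsub>C\<^esub> k x z)"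
    using g[OF xa(1) z] h[OF ay(1) w] by simp
  also have "\<dots> = l w y \<cdot>\<^bsub>C\<^esub> ((l' a w \<cdot>\<^bsub>C\<^esub> k' z a) \<cdot>\<^bsub>C\<^esub> k x z)"
    using comp_assoc[OF comp_hom[OF K K'] L' L] comp_assoc[OF K K' L'] by simp
  also have "l' a w \<cdot>\<^bsub>C\<^esub> k' z a = on_arr X (z, w)"
    using lk' za aw unfolding shift_inverse_def by blast
  also have "on_arr X (z, w) \<cdot>\<^bsub>C\<^esub> k x z = k x w" using shift_familyD(2)[OF k xz zw] .
  also have "l w y \<cdot>\<^bsub>C\<^esub> k x w = on_arr M (x, y)"
    using lk wy xw unfolding shift_inverse_def up_def by blast
  finally show "h a y \<cdot>\<^bsub>C\<^esub> g x a = on_arr M (x, y)" .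
qed

text \<open>Two intermediate point conditions appear because the way from M to N uses s first and t
  second, while the way back uses them in the opposite order.\<close>

theorem shift_interleaved_trans:
  assumes M: "diagram M" and X: "diagram X" and N: "diagram N"
    and MX: "shift_interleaved le C \<rho> s M X" and XN: "shift_interleaved le C \<rho> t X N"
    and CIP: "CIP P le \<rho>" and st: "0 \<le> s" "0 \<le> t"
    and mid: "\<And>a b. (a, b) \<in> le \<Longrightarrow> ennreal u \<le> \<rho> a b \<Longrightarrow> down le \<rho> t b \<inter> up le \<rho> s a \<noteq> {}"
    and mid': "\<And>a b. (a, b) \<in> le \<Longrightarrow> ennreal u \<le> \<rho> a b \<Longrightarrow> down le \<rho> s b \<inter> up le \<rho> t a \<noteq> {}"
  shows "shift_interleaved le C \<rho> u M N"
proof -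
  from MX obtain k l where k: "shift_family le C \<rho> s M X k" and l: "shift_family le C \<rho> s X M l"
    and kl: "shift_inverse le C \<rho> s M l k" "shift_inverse le C \<rho> s X k l"
    unfolding shift_interleaved_def by blast
  from XN obtain k' l' where k': "shift_family le C \<rho> t X N k'" and l': "shift_family le C \<rho> t N X l'"
    and kl': "shift_inverse le C \<rho> t X l' k'" "shift_inverse le C \<rho> t N k' l'"
    unfolding shift_interleaved_def by blast
  obtain g where "shift_family le C \<rho> u M N g"
    and g: "\<And>a b z. (a, b) \<in> le \<Longrightarrow> z \<in> down le \<rho> t b \<inter> up le \<rho> s a \<Longrightarrow> g a b = k' z b \<cdot>\<^bsub>C\<^esub> k a z"
    using comp_shift_family[OF M X N k k' CIP st mid] by blast
  moreover obtain h where "shift_family le C \<rho> u N M h"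
    and h: "\<And>a b z. (a, b) \<in> le \<Longrightarrow> z \<in> down le \<rho> s b \<inter> up le \<rho> t a \<Longrightarrow> h a b = l z b \<cdot>\<^bsub>C\<^esub> l' a z"
    using comp_shift_family[OF N X M l' l CIP st(2,1) mid'] by blast
  moreover have "shift_inverse le C \<rho> u M h g"
    using comp_shift_inverse[OF X k l k' l' kl(1) kl'(1) mid mid' g h] .
  \<comment> \<open>The other inverse law is the same collapse with (M, s) and (N, t)
    exchanged.\<close>
  moreover have "shift_inverse le C \<rho> u N g h"
    using comp_shift_inverse[OF X l' k' l k kl'(2) kl(2) mid' mid h g] .
  ultimately show ?thesis unfolding shift_interleaved_def by blast
qed

end

section \<open>Estimates in the extended reals and intermediate points\<close>

lemma inf_abs_diff_le:
  assumes "inf_abs_diff u v \<le> ennreal d" "0 \<le> d" "0 \<le> r" "ennreal (r + d) \<le> u"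
  shows "ennreal r \<le> v"
proof (cases u; cases v)
  fix x y assume xy: "u = ennreal x" "0 \<le> x" "v = ennreal y" "0 \<le> y"
  then have "\<bar>x - y\<bar> \<le> d" "r + d \<le> x"
    using assms by (auto simp: inf_abs_diff_def simp del: ennreal_plus)
  then have "r \<le> y" by linarith
  then show ?thesis using xy by (simp add: ennreal_leI)
\<comment> \<open>With an infinite value present, the finite bound d forces both u and v to be
  infinite, and the claim is trivial.\<close>
qed (use assms in \<open>auto simp: inf_abs_diff_def top_unique\<close>)

lemma inf_abs_diff_commute: "inf_abs_diff u v = inf_abs_diff v u"
  by (auto simp: inf_abs_diff_def abs_minus_commute)

text \<open>The excess c over s + t pays for the two errors c / 2 that \<open>IV\<close> allows, one
  on each side of z.\<close>

lemma IV_intermediate: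
  assumes IV: "IV P le \<rho> c" and c: "0 \<le> c" and st: "0 \<le> s" "0 \<le> t"
    and ab: "(a, b) \<in> le" "ennreal (s + t + c) \<le> \<rho> a b"
  shows "down le \<rho> t b \<inter> up le \<rho> s a \<noteq> {}"
proof -
  \<comment> \<open>Aiming c / 2 above s leaves at least s below z after the error. The rest of the
    interval has height at least t + c / 2, which leaves at least t above z.\<close>
  let ?m = "ennreal (s + c / 2)"
  have "?m \<le> ennreal (s + t + c)" using c st by (intro ennreal_leI) simp
  then have "?m \<le> \<rho> a b" using ab(2) by (rule order_trans)
  then obtain z where z: "(a, z) \<in> le" "(z, b) \<in> le"
    and az: "inf_abs_diff (\<rho> a z) ?m \<le> ennreal (c / 2)"
    and zb: "inf_abs_diff (\<rho> z b) (\<rho> a b - ?m) \<le> ennreal (c / 2)"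
    using IV ab(1) unfolding IV_def by (metis ennreal_less_top infinity_ennreal_def)
  have "ennreal (t + c / 2) = ennreal (s + t + c) - ?m"
    using c st by (subst ennreal_minus) (auto intro!: arg_cong[where f = ennreal])
  also have "\<dots> \<le> \<rho> a b - ?m" using ab(2) by (rule ennreal_minus_mono) simp
  finally have "ennreal t \<le> \<rho> z b"
    using inf_abs_diff_le[OF zb[unfolded inf_abs_diff_commute[of "\<rho> z b"]]] c st by simp
  moreover have "ennreal s \<le> \<rho> a z"
    using inf_abs_diff_le[OF az[unfolded inf_abs_diff_commute[of "\<rho> a z"]]] c st by simp
  ultimately show ?thesis using z by (auto simp: down_def up_def)
qed

text \<open>The infimum need not be attained; finiteness makes adding a positive e a strict
  increase, so some admissible r lies below.\<close>

lemma Inf_ennreal_approx: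
  assumes "Inf {ennreal r | r. 0 \<le> r \<and> Q r} < \<infinity>" "0 < e"
  obtains r where "0 \<le> r" "Q r" "ennreal r \<le> Inf {ennreal r | r. 0 \<le> r \<and> Q r} + ennreal e"
proof -
  let ?I = "Inf {ennreal r | r. 0 \<le> r \<and> Q r}"
  have "?I < ?I + ennreal e" using assms by (cases ?I) (auto simp: ennreal_less_iff simp flip: ennreal_plus)
  then obtain x where "x \<in> {ennreal r | r. 0 \<le> r \<and> Q r}" "x < ?I + ennreal e"
    unfolding Inf_less_iff by blast
  then show thesis using that by (auto intro: less_imp_le)
qed

section \<open>The relaxed triangle inequality\<close>

theorem corollary5p6:
  fixes C :: "('o, 'm) cat"
    and P :: "'u set"
    and le :: "'u rel"
    and \<rho>\<^sub>1 \<rho>\<^sub>2 :: "'u \<Rightarrow> 'u \<Rightarrow> ennreal"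
    and M X N :: "('u, 'o, 'm) diagram"
  assumes "category C"
    and "complete_category TYPE('u) C"
    and "cocomplete_category TYPE('u) C"
    and "partial_order_on P le"
    and "height_difference P le \<rho>\<^sub>1"
    and "height_difference P le \<rho>\<^sub>2"
    and "CIP P le \<rho>\<^sub>1"
    and "is_functor (poset_cat P le) C M"
    and "is_functor (poset_cat P le) C X"
    and "is_functor (poset_cat P le) C N"
  shows "height_dist P le C \<rho>\<^sub>2 M N
    \<le> height_dist P le C \<rho>\<^sub>2 M X + height_dist P le C \<rho>\<^sub>2 X N
      + IV_const P le \<rho>\<^sub>1 + 3 * distortion le \<rho>\<^sub>1 \<rho>\<^sub>2"
proof -
  \<comment> \<open>Two interpretations: families are composed for \<open>\<rho>\<^sub>1\<close>,
    where CIP is available, while the distances are taken for \<open>\<rho>\<^sub>2\<close>.\<close>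
  interpret h1: height_poset C P le \<rho>\<^sub>1
    using assms by (simp add: height_poset_def height_poset_axioms_def)
  interpret h2: height_poset C P le \<rho>\<^sub>2
    using assms by (simp add: height_poset_def height_poset_axioms_def)
  \<comment> \<open>The inequality for real parameters that are admissible for the four infima; the
    infima are approximated afterwards.\<close>
  have bound: "height_dist P le C \<rho>\<^sub>2 M N \<le> ennreal (s + t + c + 3 * d)"
    if s: "0 \<le> s" "height_interleaved P le C \<rho>\<^sub>2 s M X"
      and t: "0 \<le> t" "height_interleaved P le C \<rho>\<^sub>2 t X N"
      and c: "0 \<le> c" "IV P le \<rho>\<^sub>1 c"
      and d: "0 \<le> d" "\<forall>a b. (a, b) \<in> le \<longrightarrow> inf_abs_diff (\<rho>\<^sub>1 a b) (\<rho>\<^sub>2 a b) \<le> ennreal d"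
    for s t c d
  proof -
    have d12: "ennreal r \<le> \<rho>\<^sub>2 a b"
      if "(a, b) \<in> le" "ennreal (r + d) \<le> \<rho>\<^sub>1 a b" "0 \<le> r" for r a b
      using inf_abs_diff_le[of "\<rho>\<^sub>1 a b" "\<rho>\<^sub>2 a b" d r] d that by blast
    have d21: "ennreal r \<le> \<rho>\<^sub>1 a b"
      if "(a, b) \<in> le" "ennreal (r + d) \<le> \<rho>\<^sub>2 a b" "0 \<le> r" for r a b
      using inf_abs_diff_le[of "\<rho>\<^sub>2 a b" "\<rho>\<^sub>1 a b" d r] d that
      by (simp add: inf_abs_diff_commute)
    \<comment> \<open>Each of the two given interleavings pays one d for the passage to
      \<open>\<rho>\<^sub>1\<close>.\<close>
    have "shift_interleaved le C \<rho>\<^sub>1 (s + d) M X" "shift_interleaved le C \<rho>\<^sub>1 (t + d) X N"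
      using shift_interleaved_mono d12 s t assms h2.height_interleaved_iff by metis+
    then have "shift_interleaved le C \<rho>\<^sub>1 ((s + d) + (t + d) + c) M N"
      using h1.shift_interleaved_trans[OF assms(8-10), of "s + d" "t + d"] assms(7) s t d
        IV_intermediate[OF c(2,1), of "s + d" "t + d"] IV_intermediate[OF c(2,1), of "t + d" "s + d"]
      by (simp add: add.commute add.left_commute)
    \<comment> \<open>The third d is the price of returning the composite to
      \<open>\<rho>\<^sub>2\<close>.\<close>
    then have "shift_interleaved le C \<rho>\<^sub>2 ((s + d) + (t + d) + c + d) M N"
      by (rule shift_interleaved_mono) (use s t c d in \<open>auto intro!: d21 simp del: ennreal_plus\<close>)
    moreover have "(s + d) + (t + d) + c + d = s + t + c + 3 * d" by simp
    ultimately have "height_interleaved P le C \<rho>\<^sub>2 (s + t + c + 3 * d) M N"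
      using h2.height_interleaved_iff assms by metis
    then show ?thesis
      unfolding height_dist_def using s t c d by (intro Inf_lower) (auto simp del: ennreal_plus)
  qed
  let ?R = "height_dist P le C \<rho>\<^sub>2 M X + height_dist P le C \<rho>\<^sub>2 X N
      + IV_const P le \<rho>\<^sub>1 + 3 * distortion le \<rho>\<^sub>1 \<rho>\<^sub>2"
  show ?thesis
  proof (rule ennreal_le_epsilon)
    fix e :: real assume "?R < top" and e: "0 < e"
    then have fin: "height_dist P le C \<rho>\<^sub>2 M X < \<infinity>" "height_dist P le C \<rho>\<^sub>2 X N < \<infinity>"
      "IV_const P le \<rho>\<^sub>1 < \<infinity>" "distortion le \<rho>\<^sub>1 \<rho>\<^sub>2 < \<infinity>"
      by (auto simp: ennreal_mult_less_top)
    \<comment> \<open>The four approximation errors enter with weights 1, 1, 1 and 3, so sixths of e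
      add up to e.\<close>
    have e6: "0 < e / 6" using e by simp
    obtain s where s: "0 \<le> s" "height_interleaved P le C \<rho>\<^sub>2 s M X"
      and s': "ennreal s \<le> height_dist P le C \<rho>\<^sub>2 M X + ennreal (e / 6)"
      using Inf_ennreal_approx[OF fin(1)[unfolded height_dist_def] e6]
      unfolding height_dist_def by blast
    obtain t where t: "0 \<le> t" "height_interleaved P le C \<rho>\<^sub>2 t X N"
      and t': "ennreal t \<le> height_dist P le C \<rho>\<^sub>2 X N + ennreal (e / 6)"
      using Inf_ennreal_approx[OF fin(2)[unfolded height_dist_def] e6]
      unfolding height_dist_def by blast
    obtain c where c: "0 \<le> c" "IV P le \<rho>\<^sub>1 c"
      and c': "ennreal c \<le> IV_const P le \<rho>\<^sub>1 + ennreal (e / 6)"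
      using Inf_ennreal_approx[OF fin(3)[unfolded IV_const_def] e6]
      unfolding IV_const_def by blast
    obtain d where d: "0 \<le> d" "\<forall>a b. (a, b) \<in> le \<longrightarrow> inf_abs_diff (\<rho>\<^sub>1 a b) (\<rho>\<^sub>2 a b) \<le> ennreal d"
      and d': "ennreal d \<le> distortion le \<rho>\<^sub>1 \<rho>\<^sub>2 + ennreal (e / 6)"
      using Inf_ennreal_approx[OF fin(4)[unfolded distortion_def] e6]
      unfolding distortion_def by blast
    have "height_dist P le C \<rho>\<^sub>2 M N \<le> ennreal (s + t + c + 3 * d)"
      using bound[OF s t c d] .
    also have "\<dots> = ennreal s + ennreal t + ennreal c + 3 * ennreal d"
      using s t c d by (simp add: ennreal_plus ennreal_mult)
    also have "\<dots> \<le> (height_dist P le C \<rho>\<^sub>2 M X + ennreal (e / 6))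
        + (height_dist P le C \<rho>\<^sub>2 X N + ennreal (e / 6)) + (IV_const P le \<rho>\<^sub>1 + ennreal (e / 6))
        + 3 * (distortion le \<rho>\<^sub>1 \<rho>\<^sub>2 + ennreal (e / 6))"
      by (intro add_mono mult_left_mono s' t' c' d') simp
    also have "\<dots> = ?R + (1 + 1 + 1 + 3) * ennreal (e / 6)"
      by (simp only: distrib_left distrib_right mult_1 ac_simps)
    also have "(1 + 1 + 1 + 3) * ennreal (e / 6) = ennreal e"
      using e ennreal_mult[of 6 "e / 6"] by simp
    finally show "height_dist P le C \<rho>\<^sub>2 M N \<le> ?R + ennreal e" .
  qed
qed

end
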